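(* For all integers $k \geq 2$, $s(K_k \cdot K_2) = k-1$.
   Context: All graphs are finite and simple. A graph $G$ is Ramsey for $H$, written $G \rightarrow H$, if every red/blue colouring of the edges of $G$ contains a monochromatic copy of $H$. A graph $G$ is $H$-minimal if $G \rightarrow H$ but no proper subgraph of $G$ is Ramsey for $H$. For a graph $H$, $s(H)$ is the minimum of $\delta(G)$ (the minimum degree of $G$) over all $H$-minimal graphs $G$. $K_k \cdot K_2$ denotes the graph on $k+1$ vertices consisting of a complete graph $K_k$ together with one additional vertex joined by a single edge to one vertex of the $K_k$ (a pendent edge). *)

theory Defs
  imports Complex_Main "HOL-Library.Ramsey"
begin

type_synonym 'a ugraph = "'a set \<times> 'a set set"

abbreviation verts :: "'a ugraph \<Rightarrow> 'a set" where "verts \<equiv> fst"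
abbreviation edges :: "'a ugraph \<Rightarrow> 'a set set" where "edges \<equiv> snd"

definition simple_graph :: "'a ugraph \<Rightarrow> bool" where
  "simple_graph G \<longleftrightarrow> finite (verts G) \<and> edges G \<subseteq> nsets (verts G) 2"

definition subgraph :: "'a ugraph \<Rightarrow> 'a ugraph \<Rightarrow> bool" where
  "subgraph G' G \<longleftrightarrow> simple_graph G' \<and> verts G' \<subseteq> verts G \<and> edges G' \<subseteq> edges G"

definition degree :: "'a ugraph \<Rightarrow> 'a \<Rightarrow> nat" where
  "degree G v = card {e \<in> edges G. v \<in> e}"

text \<open>Unspecified on the graph without vertices, which is not Ramsey for any graph that has a vertex.\<close>
definition min_degree :: "'a ugraph \<Rightarrow> nat" where
  "min_degree G = Min (degree G ` verts G)"

text \<open>Copies are not required to be induced.\<close>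
definition contains_copy :: "'a ugraph \<Rightarrow> 'b ugraph \<Rightarrow> bool" where
  "contains_copy G H \<longleftrightarrow>
     (\<exists>f. inj_on f (verts H) \<and> f ` verts H \<subseteq> verts G \<and> (\<forall>e\<in>edges H. f ` e \<in> edges G))"

datatype colour = Red | Blue

definition colour_class :: "'a ugraph \<Rightarrow> ('a set \<Rightarrow> colour) \<Rightarrow> colour \<Rightarrow> 'a ugraph" where
  "colour_class G \<chi> c = (verts G, {e \<in> edges G. \<chi> e = c})"

text \<open>A colouring is a total function on sets of vertices; only its values on edges of the graph matter.\<close>
definition ramsey_for :: "'a ugraph \<Rightarrow> 'b ugraph \<Rightarrow> bool" where
  "ramsey_for G H \<longleftrightarrow> (\<forall>\<chi>. \<exists>c. contains_copy (colour_class G \<chi> c) H)"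

definition ramsey_minimal :: "'b ugraph \<Rightarrow> 'a ugraph \<Rightarrow> bool" where
  "ramsey_minimal H G \<longleftrightarrow> simple_graph G \<and> ramsey_for G H \<and>
     (\<forall>G'. subgraph G' G \<and> G' \<noteq> G \<longrightarrow> \<not> ramsey_for G' H)"

text \<open>
  Every finite graph is isomorphic to one with vertices in \<^typ>\<open>nat\<close>, so nothing is lost by
  restricting the host graphs to that type. The infimum of a nonempty set of natural numbers is
  its minimum; the infimum of the empty set is 0, so a positive value of
  \<open>ramsey_min_degree H\<close> also entails that some graph is minimal for \<open>H\<close>.
\<close>
definition ramsey_min_degree :: "'b ugraph \<Rightarrow> nat" where
  "ramsey_min_degree H = Inf {min_degree G | G :: nat ugraph. ramsey_minimal H G}"

text \<open>The complete graph on \<open>{..<k}\<close> with the pendent edge \<open>{0, k}\<close>; meant for \<open>k \<ge> 1\<close>.\<close>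
definition clique_pendent :: "nat \<Rightarrow> nat ugraph" where
  "clique_pendent k = ({..k}, insert {0, k} (nsets {..<k} 2))"

end

theory Submission
  imports Defs "HOL-Library.FuncSet" "HOL-Library.Nat_Bijection"
begin

text \<open>
  In a colouring without a monochromatic \<open>K\<^sub>k \<cdot> K\<^sub>2\<close> (a good colouring) every monochromatic
  \<open>K\<^sub>k\<close> is a component of its colour.

  Lower bound: let \<open>x\<close> have degree less than \<open>k - 1\<close> and take a good colouring of \<open>G - x\<close>. In every
  monochromatic \<open>K\<^sub>k\<close> that has a vertex lying in both a red and a blue \<open>K\<^sub>k\<close>, flip one edge at such a
  vertex. The new colouring is good and has no vertex in both a red and a blue \<open>K\<^sub>k\<close>, so the edges
  at \<open>x\<close>, which lie in no \<open>K\<^sub>k\<close>, can be coloured as well.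

  Upper bound: let \<open>n\<close> be maximal with a colouring \<open>\<alpha>\<close> of \<open>K\<^sub>n\<close> without red \<open>K\<^sub>k\<close> and blue
  \<open>K\<^bsub>k-1\<^esub>\<close>. Then every colouring of \<open>K\<^sub>n\<close> has a monochromatic \<open>K\<^bsub>k-1\<^esub>\<close>, and either a red \<open>K\<^sub>k\<close> or
  a blue \<open>K\<^bsub>k-2\<^esub>\<close>. Take a graph \<open>Y\<close>, coloured without red \<open>K\<^sub>k\<close> and blue \<open>K\<^bsub>k-1\<^esub>\<close>, in which every
  partition of the vertices into \<open>2\<^sup>k\<close> classes has a class containing a \<open>K\<^sub>n\<close>. The join \<open>F\<close> of \<open>Y\<close> and a
  \<open>K\<^sub>k\<close> is Ramsey for \<open>K\<^sub>k\<close>: split \<open>Y\<close> by the colours of the edges to the \<open>K\<^sub>k\<close>. But making the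
  \<open>K\<^sub>k\<close> red and its edges to \<open>Y\<close> blue gives a good colouring without blue \<open>K\<^sub>k\<close>. Now connect
  disjoint copies of \<open>F\<close> by copies of \<open>K\<^bsub>k-1\<^esub>\<close> such that every set meeting all copies of \<open>F\<close> contains one
  of these \<open>K\<^bsub>k-1\<^esub>\<close>; colouring the connections blue is good. In any good colouring some connecting
  \<open>K\<^bsub>k-1\<^esub>\<close> has each vertex in a monochromatic \<open>K\<^sub>k\<close> of a copy of \<open>F\<close>, which forces one colour on all edges
  leaving these cliques at that \<open>K\<^bsub>k-1\<^esub>\<close>. Hence after joining two new vertices to every set of \<open>k - 1\<close>
  vertices no good colouring is left.
\<close>

subsection \<open>Monochromatic cliques with a pendent edge\<close>

text \<open>A bare relation as argument lets one notion cover colour classes of a host graph,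
  coloured graphs on \<open>nat\<close> and colourings of index sets. \<open>pairwise\<close> looks
  at distinct elements only, so \<open>r\<close> may hold on the diagonal.\<close>

definition k_clique :: "nat \<Rightarrow> ('a \<Rightarrow> 'a \<Rightarrow> bool) \<Rightarrow> 'a set \<Rightarrow> bool" where
  "k_clique k r K \<longleftrightarrow> finite K \<and> card K = k \<and> pairwise r K"

definition has_pendent :: "nat \<Rightarrow> ('a \<Rightarrow> 'a \<Rightarrow> bool) \<Rightarrow> bool" where
  "has_pendent k r \<longleftrightarrow> (\<exists>K u w. k_clique k r K \<and> u \<in> K \<and> w \<notin> K \<and> r u w)"

definition mono_adj :: "'a set set \<Rightarrow> ('a set \<Rightarrow> colour) \<Rightarrow> colour \<Rightarrow> 'a \<Rightarrow> 'a \<Rightarrow> bool" where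
  "mono_adj E \<chi> c x y \<longleftrightarrow> {x, y} \<in> E \<and> \<chi> {x, y} = c"

lemma k_clique_mono: "k_clique k r K \<Longrightarrow> (\<And>x y. x \<noteq> y \<Longrightarrow> r x y \<Longrightarrow> r' x y) \<Longrightarrow> k_clique k r' K"
  by (auto simp: k_clique_def pairwise_def)

lemma has_pendentI: "k_clique k r K \<Longrightarrow> u \<in> K \<Longrightarrow> w \<notin> K \<Longrightarrow> r u w \<Longrightarrow> has_pendent k r"
  unfolding has_pendent_def by blast

lemma has_pendentE:
  assumes "has_pendent k r"
  obtains K u w where "k_clique k r K" "u \<in> K" "w \<notin> K" "u \<noteq> w" "r u w"
  using assms unfolding has_pendent_def by blast

lemma has_pendent_mono:
  assumes "has_pendent k r" "\<And>x y. x \<noteq> y \<Longrightarrow> r x y \<Longrightarrow> r' x y"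
  shows "has_pendent k r'"
  using assms(1)
proof (rule has_pendentE)
  fix K u w assume "k_clique k r K" "u \<in> K" "w \<notin> K" "u \<noteq> w" "r u w"
  moreover from this have "k_clique k r' K" by (auto intro: k_clique_mono assms(2))
  ultimately show ?thesis by (auto intro: has_pendentI assms(2))
qed

lemma mono_adj_commute: "mono_adj E \<chi> c x y = mono_adj E \<chi> c y x"
  by (simp add: mono_adj_def insert_commute)

lemma card_two_ex_other: "2 \<le> card K \<Longrightarrow> x \<in> K \<Longrightarrow> \<exists>y\<in>K. y \<noteq> x"
  using card_mono[of "{x}" K] by fastforce

text \<open>This replaces embeddings by sets of vertices. The vertex set of \<open>G\<close>
  disappears because, for \<open>k \<ge> 2\<close>, every vertex of the pattern lies on an
  edge.\<close>

lemma contains_copy_clique_pendent_iff: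
  assumes G: "simple_graph G" and k: "k \<ge> 2"
  shows "contains_copy (colour_class G \<chi> c) (clique_pendent k) \<longleftrightarrow> has_pendent k (mono_adj (edges G) \<chi> c)"
proof
  assume "contains_copy (colour_class G \<chi> c) (clique_pendent k)"
  then obtain f where f: "inj_on f {..k}"
    and fe: "\<And>e. e \<in> insert {0, k} (nsets {..<k} 2) \<Longrightarrow> f ` e \<in> edges G \<and> \<chi> (f ` e) = c"
    unfolding contains_copy_def colour_class_def clique_pendent_def fst_conv snd_conv by blast
  have "k_clique k (mono_adj (edges G) \<chi> c) (f ` {..<k})"
    unfolding k_clique_def pairwise_def
  proof (intro conjI ballI impI)
    show "card (f ` {..<k}) = k"
    proof -
      have "{..<k} \<subseteq> {..k}" by auto
      from card_image[OF inj_on_subset[OF f this]] show ?thesis by simp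
    qed
    fix x y assume "x \<in> f ` {..<k}" "y \<in> f ` {..<k}" "x \<noteq> y"
    then obtain i j where "i < k" "j < k" "x = f i" "y = f j" "i \<noteq> j" by auto
    then have "{i, j} \<in> nsets {..<k} 2" by (auto simp: nsets_def)
    then show "mono_adj (edges G) \<chi> c x y"
      using fe[of "{i, j}"] \<open>x = f i\<close> \<open>y = f j\<close> by (simp add: mono_adj_def)
  qed simp
  moreover have "f k \<notin> f ` {..<k}" using f by (auto dest!: inj_onD)
  moreover have "mono_adj (edges G) \<chi> c (f 0) (f k)" using fe[of "{0, k}"] by (simp add: mono_adj_def)
  ultimately show "has_pendent k (mono_adj (edges G) \<chi> c)"
    using k by (intro has_pendentI) auto
next
  assume "has_pendent k (mono_adj (edges G) \<chi> c)"
  then obtain K u w where K: "finite K" "card K = k" "pairwise (mono_adj (edges G) \<chi> c) K"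
    and uw: "u \<in> K" "w \<notin> K" "mono_adj (edges G) \<chi> c u w"
    by (auto simp: has_pendent_def k_clique_def)
  have sub: "x \<in> verts G \<and> y \<in> verts G" if "mono_adj (edges G) \<chi> c x y" for x y
    using that G by (auto simp: mono_adj_def simple_graph_def nsets_def)
  obtain h where h: "bij_betw h {0<..<k} (K - {u})"
    using finite_same_card_bij[of "{0<..<k}" "K - {u}"] K uw by auto
  \<comment> \<open>The vertex 0 carries the pendent edge, so it goes to \<open>u\<close>, and
    \<open>k\<close> goes to the leaf \<open>w\<close>; any bijection fills the rest of the
    clique.\<close>
  define f where "f i = (if i = 0 then u else if i = k then w else h i)" for i
  have hK: "h i \<in> K \<and> h i \<noteq> u" if "0 < i" "i < k" for i
    using h that by (auto simp: bij_betw_def)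
  have fK: "f i \<in> K" if "i < k" for i
    using that uw hK[of i] by (auto simp: f_def)
  have inj: "inj_on f {..k}"
  proof -
    have "inj_on f {0<..<k}"
      using h by (auto simp: bij_betw_def inj_on_def f_def)
    moreover have "f ` {0<..<k} \<subseteq> K - {u}"
    proof
      fix y assume "y \<in> f ` {0<..<k}"
      then obtain i where "0 < i" "i < k" "y = f i" by auto
      then show "y \<in> K - {u}" using hK[of i] by (simp add: f_def)
    qed
    ultimately have "inj_on f (insert 0 (insert k {0<..<k}))"
      using uw k by (auto simp: inj_on_insert f_def)
    moreover have "{..k} = insert 0 (insert k {0<..<k})" by auto
    ultimately show ?thesis by simp
  qed
  have adj: "mono_adj (edges G) \<chi> c (f i) (f j)" if "i < k" "j < k" "i \<noteq> j" for i j
    using pairwiseD[OF K(3) fK fK] inj_onD[OF inj, of i j] that by auto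
  have edge: "f ` e \<in> edges G \<and> \<chi> (f ` e) = c" if "e \<in> insert {0, k} (nsets {..<k} 2)" for e
  proof (cases "e = {0, k}")
    case True
    then show ?thesis using uw k by (auto simp: f_def mono_adj_def insert_commute)
  next
    case False
    then have "e \<subseteq> {..<k}" "card e = 2" using that by (auto simp: nsets_def)
    then obtain i j where "e = {i, j}" "i < k" "j < k" "i \<noteq> j"
      by (auto simp: card_2_iff)
    then show ?thesis using adj[of i j] by (simp add: mono_adj_def)
  qed
  have V: "f i \<in> verts G" if "i \<le> k" for i
  proof (cases "i = k")
    case True then show ?thesis using sub[OF uw(3)] k by (auto simp: f_def)
  next
    case False
    then have "f i \<in> K" using fK that by simp
    then obtain y where "y \<in> K" "y \<noteq> f i"
      using card_two_ex_other[of K "f i"] K(2) k by auto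
    then show ?thesis using pairwiseD[OF K(3) \<open>f i \<in> K\<close>] sub by blast
  qed
  show "contains_copy (colour_class G \<chi> c) (clique_pendent k)"
    unfolding contains_copy_def colour_class_def clique_pendent_def
    using inj V edge by (intro exI[of _ f]) auto
qed

lemma ramsey_for_clique_pendent_iff:
  assumes "simple_graph G" "k \<ge> 2"
  shows "ramsey_for G (clique_pendent k) \<longleftrightarrow> (\<forall>\<chi>. \<exists>c. has_pendent k (mono_adj (edges G) \<chi> c))"
  using assms by (simp add: ramsey_for_def contains_copy_clique_pendent_iff)

subsection \<open>Flipping saturated cliques\<close>

fun opp :: "colour \<Rightarrow> colour" where
  "opp Red = Blue" | "opp Blue = Red"

lemma opp_opp [simp]: "opp (opp c) = c"
  by (cases c) auto

lemma opp_neq [simp]: "opp c \<noteq> c" "c \<noteq> opp c"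
  by (cases c; simp)+

lemma opp_eq_iff: "opp c = d \<longleftrightarrow> c \<noteq> d"
  by (cases c; cases d) auto

locale pendent_free_colouring =
  fixes k :: nat and E :: "'a set set" and \<chi> :: "'a set \<Rightarrow> colour"
  assumes k3: "k \<ge> 3"
    and free: "\<not> has_pendent k (mono_adj E \<chi> c)"
begin

abbreviation mono_clique :: "colour \<Rightarrow> 'a set \<Rightarrow> bool" where
  "mono_clique c \<equiv> k_clique k (mono_adj E \<chi> c)"

definition saturated :: "'a \<Rightarrow> bool" where
  "saturated u \<longleftrightarrow> (\<forall>c. \<exists>K. mono_clique c K \<and> u \<in> K)"

lemma mono_clique_closed:
  "mono_clique c K \<Longrightarrow> u \<in> K \<Longrightarrow> mono_adj E \<chi> c u w \<Longrightarrow> w \<in> K"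
  using free has_pendentI by metis

lemma mono_clique_adj:
  "mono_clique c K \<Longrightarrow> u \<in> K \<Longrightarrow> w \<in> K \<Longrightarrow> u \<noteq> w \<Longrightarrow> mono_adj E \<chi> c u w"
  by (auto simp: k_clique_def pairwise_def)

lemma mono_clique_unique:
  assumes "mono_clique c K" "mono_clique c L" "u \<in> K" "u \<in> L"
  shows "K = L"
  using assms mono_clique_closed mono_clique_adj by blast

lemma mono_clique_meet:
  assumes "mono_clique c K" "mono_clique (opp c) L" "u \<in> K" "u \<in> L" "w \<in> K" "w \<in> L"
  shows "u = w"
  using mono_clique_adj[OF assms(1), of u w] mono_clique_adj[OF assms(2), of u w] assms(3-)
  by (cases "u = w") (auto simp: mono_adj_def)

text \<open>The choice depends on \<open>K\<close> alone, so each clique gives up a single edge even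
  if it has several saturated vertices.\<close>

definition flip_edge :: "'a set \<Rightarrow> 'a set" where
  "flip_edge K = (SOME e. \<exists>s y. e = {s, y} \<and> s \<in> K \<and> y \<in> K \<and> s \<noteq> y \<and> saturated s)"

lemma flip_edge:
  assumes "mono_clique c K" "s \<in> K" "saturated s"
  shows "\<exists>s y. flip_edge K = {s, y} \<and> s \<in> K \<and> y \<in> K \<and> s \<noteq> y \<and> saturated s"
proof -
  have "2 \<le> card K" using assms(1) k3 by (simp add: k_clique_def)
  then obtain y where "y \<in> K" "y \<noteq> s" using card_two_ex_other assms(2) by metis
  then have "\<exists>e s y. e = {s, y} \<and> s \<in> K \<and> y \<in> K \<and> s \<noteq> y \<and> saturated s"
    using assms by blast
  then show ?thesis unfolding flip_edge_def by (rule someI_ex)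
qed

definition flipped :: "'a set set" where
  "flipped = {flip_edge K | K c s. mono_clique c K \<and> s \<in> K \<and> saturated s}"

definition flip_col :: "'a set \<Rightarrow> colour" where
  "flip_col e = (if e \<in> flipped then opp (\<chi> e) else \<chi> e)"

lemma flippedE:
  assumes "{a, b} \<in> flipped" "mono_adj E \<chi> c a b"
  obtains K where "mono_clique c K" "{a, b} = flip_edge K" "a \<in> K" "b \<in> K" "a \<noteq> b" "saturated a \<or> saturated b"
proof -
  obtain K d s where K: "{a, b} = flip_edge K" "mono_clique d K" "s \<in> K" "saturated s"
    using assms(1) by (auto simp: flipped_def)
  obtain s y where y: "flip_edge K = {s, y}" "s \<in> K" "y \<in> K" "s \<noteq> y" "saturated s"
    using flip_edge[OF K(2-4)] by blast
  have ab: "a \<in> K" "b \<in> K" "a \<noteq> b" "saturated a \<or> saturated b"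
    using y K(1) by (auto simp: doubleton_eq_iff)
  then have "mono_adj E \<chi> d a b" using K mono_clique_adj by blast
  then have "d = c" using assms(2) by (simp add: mono_adj_def)
  then show ?thesis using that K ab by blast
qed

lemma flip_adj_cases:
  assumes "mono_adj E flip_col c u w"
  obtains "mono_adj E \<chi> c u w" "{u, w} \<notin> flipped"
    | K where "mono_clique (opp c) K" "{u, w} = flip_edge K" "u \<in> K" "w \<in> K" "u \<noteq> w" "saturated u \<or> saturated w"
proof (cases "{u, w} \<in> flipped")
  case False
  then show ?thesis using assms that(1) by (simp add: mono_adj_def flip_col_def)
next
  case True
  then have "mono_adj E \<chi> (opp c) u w"
    using assms by (auto simp: mono_adj_def flip_col_def)
  then show ?thesis using True flippedE that(2) by metis
qed

text \<open>The flipped edges that receive colour \<open>c\<close> form a matching, and a saturated end of such an edge lies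
  in a \<open>c\<close>-coloured component that does not contain the other end. Hence no triangle uses them.\<close>
lemma flip_adj_triangle:
  assumes "mono_adj E flip_col c a b" "mono_adj E flip_col c a z" "mono_adj E flip_col c b z"
    and "a \<noteq> b" "a \<noteq> z" "b \<noteq> z"
  shows "mono_adj E \<chi> c a b \<and> {a, b} \<notin> flipped"
proof -
  have False if L: "mono_clique (opp c) L" "{s, y} = flip_edge L" "s \<in> L" "y \<in> L" "s \<noteq> y" "saturated s"
    and z: "mono_adj E flip_col c s z" "mono_adj E flip_col c y z" "z \<noteq> s" "z \<noteq> y" for s y L
  proof -
    \<comment> \<open>\<open>L\<close> is the only clique of its colour through \<open>v\<close> and
      its chosen edge is \<open>{s, y}\<close>, so the edge from \<open>v\<close> to
      \<open>z\<close> had colour \<open>c\<close> from the start.\<close>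
    have no: "mono_adj E \<chi> c v z" if v: "v \<in> {s, y}" for v
    proof -
      have "mono_adj E flip_col c v z" using z v by auto
      then show ?thesis
      proof (cases rule: flip_adj_cases)
        case (2 K)
        then have "K = L" using mono_clique_unique[OF 2(1) L(1), of v] v L by blast
        then show ?thesis using 2 L v z by (auto simp: doubleton_eq_iff)
      qed
    qed
    obtain A where A: "mono_clique c A" "s \<in> A" using L(6) by (auto simp: saturated_def)
    then have "z \<in> A" using no mono_clique_closed by blast
    then have "y \<in> A" using no[of y] A mono_clique_closed mono_adj_commute by (metis insert_iff)
    then show False using mono_clique_meet[OF A(1) L(1)] A L by blast
  qed
  note * = this
  from assms(1) show ?thesis
  proof (cases rule: flip_adj_cases)
    case (2 K)
    then show ?thesis using *[of K a b] *[of K b a] assms by (auto simp: insert_commute)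
  qed simp
qed

text \<open>As \<open>k \<ge> 3\<close>, each edge of a new clique lies in a triangle of it and so
  is not flipped. Hence the clique is an old one, and a saturated vertex would have cost it an
  edge.\<close>

lemma flip_clique:
  assumes "k_clique k (mono_adj E flip_col c) K"
  shows "mono_clique c K \<and> (\<forall>s\<in>K. \<not> saturated s)"
proof -
  have adj: "mono_adj E \<chi> c a b \<and> {a, b} \<notin> flipped" if ab: "a \<in> K" "b \<in> K" "a \<noteq> b" for a b
  proof -
    have "\<not> K \<subseteq> {a, b}"
      using assms k3 card_mono[of "{a, b}" K] ab by (auto simp: k_clique_def)
    then obtain z where "z \<in> K" "z \<noteq> a" "z \<noteq> b" by blast
    then show ?thesis
      using assms ab flip_adj_triangle[of c a b z] by (auto simp: k_clique_def pairwise_def)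
  qed
  then have K: "mono_clique c K" using assms by (auto simp: k_clique_def pairwise_def)
  have "\<not> saturated s" if s: "s \<in> K" for s
  proof
    assume "saturated s"
    then have "flip_edge K \<in> flipped" using K s by (auto simp: flipped_def)
    then show False using flip_edge[OF K s \<open>saturated s\<close>] adj by metis
  qed
  then show ?thesis using K by blast
qed

text \<open>A clique of the new colouring is an old one, so a pendent edge at it must be flipped.
  Its end in the clique then also lies in an old clique of the other colour, but saturated vertices
  lie in no new clique.\<close>

lemma flip_free: "\<not> has_pendent k (mono_adj E flip_col c)"
proof
  assume "has_pendent k (mono_adj E flip_col c)"
  then obtain K u w where K: "k_clique k (mono_adj E flip_col c) K" "u \<in> K" "w \<notin> K"
    and uw: "mono_adj E flip_col c u w" by (auto simp: has_pendent_def)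
  then have mono: "mono_clique c K" and unsat: "\<not> saturated u" using flip_clique by blast+
  from uw show False
  proof (cases rule: flip_adj_cases)
    case 1
    then show False using mono mono_clique_closed K by blast
  next
    case (2 L)
    have "\<exists>M. mono_clique d M \<and> u \<in> M" for d
      using mono 2(1,3) K(2) by (cases "d = c") (auto simp flip: opp_eq_iff)
    then show False using unsat by (simp add: saturated_def)
  qed
qed

lemma flip_not_both:
  "\<not> (\<forall>c. \<exists>K. k_clique k (mono_adj E flip_col c) K \<and> u \<in> K)"
proof
  assume *: "\<forall>c. \<exists>K. k_clique k (mono_adj E flip_col c) K \<and> u \<in> K"
  then have "saturated u" unfolding saturated_def using flip_clique by blast
  then show False using * flip_clique by blast
qed

end

section \<open>Colouring the edges at a vertex of small degree\<close>

lemma pendent_free_unsaturated: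
  assumes "k \<ge> 3" "\<And>c. \<not> has_pendent k (mono_adj E \<chi> c)"
  obtains \<chi>' where "\<And>c. \<not> has_pendent k (mono_adj E \<chi>' c)"
    and "\<And>u. \<exists>c. \<forall>K. k_clique k (mono_adj E \<chi>' c) K \<longrightarrow> u \<notin> K"
proof -
  interpret pendent_free_colouring k E \<chi> by unfold_locales (use assms in auto)
  show ?thesis using that[of flip_col] flip_free flip_not_both by metis
qed

text \<open>Fewer than \<open>k - 1\<close> edges keep \<open>x\<close> out of every clique, so it
  can only be the leaf. Each edge from \<open>x\<close> to \<open>u\<close> takes a colour in which
  \<open>u\<close> lies in no clique.\<close>

lemma extend_pendent_free:
  fixes E :: "'a set set"
  assumes fin: "finite {e \<in> E. x \<in> e}" and deg: "card {e \<in> E. x \<in> e} < k - 1"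
    and free: "\<And>c. \<not> has_pendent k (mono_adj {e \<in> E. x \<notin> e} \<chi> c)"
  shows "\<exists>\<chi>. \<forall>c. \<not> has_pendent k (mono_adj E \<chi> c)"
proof (cases "{e \<in> E. x \<in> e} = {}")
  case True
  then have "{e \<in> E. x \<notin> e} = E" by auto
  then show ?thesis using free by auto
next
  case False
  then have "card {e \<in> E. x \<in> e} > 0" using fin by (simp add: card_gt_0_iff)
  \<comment> \<open>The flipping needs \<open>k \<ge> 3\<close>, which follows from the presence of
    an edge at \<open>x\<close>; without one the old colouring serves.\<close>
  then have "k \<ge> 3" using deg by linarith
  let ?E = "{e \<in> E. x \<notin> e}"
  obtain \<psi> where \<psi>: "\<And>c. \<not> has_pendent k (mono_adj ?E \<psi> c)"
    and "\<And>u. \<exists>c. \<forall>K. k_clique k (mono_adj ?E \<psi> c) K \<longrightarrow> u \<notin> K"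
    using pendent_free_unsaturated[OF \<open>k \<ge> 3\<close> free] by blast
  then obtain f where f: "\<And>u K. k_clique k (mono_adj ?E \<psi> (f u)) K \<Longrightarrow> u \<notin> K" by metis
  \<comment> \<open>\<open>the_elem (e - {x})\<close> is the end of \<open>e\<close> other than
    \<open>x\<close>.\<close>
  define \<phi> where "\<phi> e = (if x \<in> e then f (the_elem (e - {x})) else \<psi> e)" for e
  have "\<not> has_pendent k (mono_adj E \<phi> c)" for c
  proof
    assume "has_pendent k (mono_adj E \<phi> c)"
    then obtain K u w where K: "k_clique k (mono_adj E \<phi> c) K" and uw: "u \<in> K" "w \<notin> K" "mono_adj E \<phi> c u w"
      by (auto simp: has_pendent_def)
    have "x \<notin> K"
    proof
      assume x: "x \<in> K"
      have "(\<lambda>y. {x, y}) ` (K - {x}) \<subseteq> {e \<in> E. x \<in> e}"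
        using K x by (auto simp: k_clique_def pairwise_def mono_adj_def)
      moreover have "inj_on (\<lambda>y. {x, y}) (K - {x})" by (auto simp: inj_on_def doubleton_eq_iff)
      ultimately have "card (K - {x}) \<le> card {e \<in> E. x \<in> e}" using fin by (intro card_inj_on_le)
      then show False using K x deg by (simp add: k_clique_def)
    qed
    have off: "mono_adj ?E \<psi> c a b" if "mono_adj E \<phi> c a b" "a \<noteq> x" "b \<noteq> x" for a b
      using that by (auto simp: mono_adj_def \<phi>_def)
    have K': "k_clique k (mono_adj ?E \<psi> c) K"
      unfolding k_clique_def
    proof (intro conjI pairwiseI)
      fix a b assume "a \<in> K" "b \<in> K" "a \<noteq> b"
      then show "mono_adj ?E \<psi> c a b"
        using K \<open>x \<notin> K\<close> by (intro off) (auto simp: k_clique_def pairwise_def)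
    qed (use K in \<open>auto simp: k_clique_def\<close>)
    show False
    proof (cases "w = x")
      case True
      then have "{u, w} - {x} = {u}" using uw \<open>x \<notin> K\<close> by auto
      then have "c = f u" using uw True by (auto simp: mono_adj_def \<phi>_def)
      then show False using f K' uw by blast
    next
      case False
      then have "mono_adj ?E \<psi> c u w" using uw \<open>x \<notin> K\<close> by (intro off) auto
      then show False using \<psi> K' uw has_pendentI by metis
    qed
  qed
  then show ?thesis by blast
qed

subsection \<open>Connecting copies of a graph by coloured cliques\<close>

text \<open>A finite simple graph with a fixed colouring of its edges; the underlying graph is the
  union of both relations.\<close>

definition coloured_graph :: "'a set \<Rightarrow> (colour \<Rightarrow> 'a \<Rightarrow> 'a \<Rightarrow> bool) \<Rightarrow> bool" where
  "coloured_graph V r \<longleftrightarrow> finite V \<and>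
     (\<forall>c u v. r c u v \<longrightarrow> u \<in> V \<and> v \<in> V \<and> u \<noteq> v \<and> r c v u) \<and>
     (\<forall>c d u v. r c u v \<longrightarrow> r d u v \<longrightarrow> c = d)"

text \<open>Injectivity of \<open>f\<close> on the indices is not demanded; it follows whenever
  \<open>r\<close> is loopless.\<close>

definition pattern_copy :: "(nat set \<Rightarrow> colour) \<Rightarrow> nat \<Rightarrow> (colour \<Rightarrow> 'a \<Rightarrow> 'a \<Rightarrow> bool) \<Rightarrow> (nat \<Rightarrow> 'a) \<Rightarrow> bool" where
  "pattern_copy \<alpha> n r f \<longleftrightarrow> (\<forall>i<n. \<forall>j<n. i \<noteq> j \<longrightarrow> r (\<alpha> {i, j}) (f i) (f j))"

text \<open>\<open>(Z, Q)\<close> consists of the copies \<open>p ` V\<close> (\<open>p \<in> \<P>\<close>) of \<open>(V, P)\<close> and further edges between them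
  that form complete graphs coloured by \<open>\<alpha>\<close>.\<close>
definition amalgam :: "nat set \<Rightarrow> (colour \<Rightarrow> nat \<Rightarrow> nat \<Rightarrow> bool) \<Rightarrow> (nat set \<Rightarrow> colour) \<Rightarrow> nat \<Rightarrow>
    nat set \<Rightarrow> (colour \<Rightarrow> nat \<Rightarrow> nat \<Rightarrow> bool) \<Rightarrow> (nat \<Rightarrow> nat) set \<Rightarrow> bool" where
  "amalgam V P \<alpha> n Z Q \<P> \<longleftrightarrow>
     coloured_graph Z Q \<and>
     (\<forall>p\<in>\<P>. inj_on p V \<and> p ` V \<subseteq> Z \<and> (\<forall>c u v. P c u v \<longrightarrow> Q c (p u) (p v))) \<and>
     (\<forall>S. (\<forall>p\<in>\<P>. S \<inter> p ` V \<noteq> {}) \<longrightarrow>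
       (\<exists>f. f ` {..<n} \<subseteq> S \<inter> Z \<and> pattern_copy \<alpha> n Q f \<and>
         (\<forall>p\<in>\<P>. \<forall>i<n. \<forall>j<n. f i \<in> p ` V \<longrightarrow> f j \<in> p ` V \<longrightarrow> i = j))) \<and>
     (\<forall>c s K. 2 \<le> s \<longrightarrow> k_clique s (Q c) K \<longrightarrow>
       (\<exists>K. k_clique s (P c) K) \<or> (\<exists>K\<subseteq>{..<n}. k_clique s (\<lambda>i j. \<alpha> {i, j} = c) K)) \<and>
     (\<forall>c k. 2 \<le> k \<longrightarrow> has_pendent k (Q c) \<longrightarrow>
       has_pendent k (P c) \<or> (\<exists>i<n. \<exists>j<n. i \<noteq> j \<and> \<alpha> {i, j} = c))"

lemma k_clique_preimage:
  assumes "k_clique s r K" "inj f" "K \<subseteq> range f" "\<And>a b. r (f a) (f b) \<Longrightarrow> r' a b"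
  shows "k_clique s r' (f -` K)"
  using assms card_vimage_inj[of f K] finite_vimageI[of K f]
  by (auto simp: k_clique_def pairwise_def inj_eq)

lemma k_clique_imp_neighbour:
  assumes "k_clique s r K" "2 \<le> s" "u \<in> K"
  shows "\<exists>v. r u v \<and> r v u"
proof -
  have "2 \<le> card K" using assms by (simp add: k_clique_def)
  then obtain v where "v \<in> K" "v \<noteq> u" using card_two_ex_other \<open>u \<in> K\<close> by metis
  then have "r u v \<and> r v u" using assms by (simp add: k_clique_def pairwise_def)
  then show ?thesis by blast
qed

lemma
  assumes "amalgam V P \<alpha> n Z Q \<P>"
  shows amalgam_graph: "coloured_graph Z Q"
    and amalgam_copy: "p \<in> \<P> \<Longrightarrow> inj_on p V \<and> p ` V \<subseteq> Z \<and> (\<forall>c u v. P c u v \<longrightarrow> Q c (p u) (p v))"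
    and amalgam_hitting: "(\<And>p. p \<in> \<P> \<Longrightarrow> S \<inter> p ` V \<noteq> {}) \<Longrightarrow>
       \<exists>f. f ` {..<n} \<subseteq> S \<inter> Z \<and> pattern_copy \<alpha> n Q f \<and>
         (\<forall>p\<in>\<P>. \<forall>i<n. \<forall>j<n. f i \<in> p ` V \<longrightarrow> f j \<in> p ` V \<longrightarrow> i = j)"
    and amalgam_clique: "2 \<le> s \<Longrightarrow> k_clique s (Q c) K \<Longrightarrow>
       (\<exists>K. k_clique s (P c) K) \<or> (\<exists>K\<subseteq>{..<n}. k_clique s (\<lambda>i j. \<alpha> {i, j} = c) K)"
    and amalgam_pendent: "2 \<le> k \<Longrightarrow> has_pendent k (Q c) \<Longrightarrow>
       has_pendent k (P c) \<or> (\<exists>i<n. \<exists>j<n. i \<noteq> j \<and> \<alpha> {i, j} = c)"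
proof -
  note * = assms[unfolded amalgam_def]
  show "coloured_graph Z Q" using * by (elim conjE)
  show "inj_on p V \<and> p ` V \<subseteq> Z \<and> (\<forall>c u v. P c u v \<longrightarrow> Q c (p u) (p v))" if "p \<in> \<P>"
    using *[THEN conjunct2, THEN conjunct1] that by (rule bspec)
  show "\<exists>f. f ` {..<n} \<subseteq> S \<inter> Z \<and> pattern_copy \<alpha> n Q f \<and>
      (\<forall>p\<in>\<P>. \<forall>i<n. \<forall>j<n. f i \<in> p ` V \<longrightarrow> f j \<in> p ` V \<longrightarrow> i = j)"
    if "\<And>p. p \<in> \<P> \<Longrightarrow> S \<inter> p ` V \<noteq> {}"
    using *[THEN conjunct2, THEN conjunct2, THEN conjunct1, rule_format] that by simp
  show "(\<exists>K. k_clique s (P c) K) \<or> (\<exists>K\<subseteq>{..<n}. k_clique s (\<lambda>i j. \<alpha> {i, j} = c) K)"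
    if "2 \<le> s" "k_clique s (Q c) K"
    using *[THEN conjunct2, THEN conjunct2, THEN conjunct2, THEN conjunct1, rule_format, OF that] .
  show "has_pendent k (P c) \<or> (\<exists>i<n. \<exists>j<n. i \<noteq> j \<and> \<alpha> {i, j} = c)"
    if "2 \<le> k" "has_pendent k (Q c)"
    using *[THEN conjunct2, THEN conjunct2, THEN conjunct2, THEN conjunct2, rule_format, OF that] .
qed

section \<open>Induction step of the amalgam: one more point in the pattern\<close>

locale amalgam_step =
  fixes V :: "nat set" and P :: "colour \<Rightarrow> nat \<Rightarrow> nat \<Rightarrow> bool" and \<alpha> :: "nat set \<Rightarrow> colour" and n :: nat
    and Z :: "nat set" and Q :: "colour \<Rightarrow> nat \<Rightarrow> nat \<Rightarrow> bool" and \<P> :: "(nat \<Rightarrow> nat) set"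
  assumes VP: "coloured_graph V P" "V \<noteq> {}"
    and ZQ: "amalgam V P \<alpha> n Z Q \<P>"
begin

definition positions :: "(nat \<Rightarrow> nat) set" where
  "positions = {f \<in> {..<n} \<rightarrow>\<^sub>E Z. pattern_copy \<alpha> n Q f}"

text \<open>A choice fixes a copy of the old pattern in every block \<open>L x\<close>, one block
  for each vertex \<open>x\<close> of \<open>V\<close>. Each choice \<open>g\<close> gets its own
  copy \<open>R (index g)\<close> of \<open>V\<close>; extensional functions keep their number
  finite.\<close>

definition choices :: "(nat \<Rightarrow> nat \<Rightarrow> nat) set" where
  "choices = V \<rightarrow>\<^sub>E positions"

definition index :: "(nat \<Rightarrow> nat \<Rightarrow> nat) \<Rightarrow> nat" where
  "index = (SOME h. inj_on h choices)"

text \<open>The first component is a tag, 0 for the blocks of old amalgams and \<open>Suc m\<close>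
  for new copies, so all vertices stay natural numbers and the blocks are disjoint.\<close>

definition L :: "nat \<Rightarrow> nat \<Rightarrow> nat" where "L x a = prod_encode (0, prod_encode (x, a))"
definition R :: "nat \<Rightarrow> nat \<Rightarrow> nat" where "R m y = prod_encode (Suc m, y)"

lemma LR_simps [simp]:
  "L x a = L x' b \<longleftrightarrow> x = x' \<and> a = b" "R m y = R m' y' \<longleftrightarrow> m = m' \<and> y = y'" "L x a \<noteq> R m y" "R m y \<noteq> L x a"
  by (auto simp: L_def R_def)

lemma inj_L [simp]: "inj (L x)" and inj_R [simp]: "inj (R m)"
  by (auto simp: inj_def)

text \<open>The vertex \<open>R m y\<close> plays the last index \<open>n\<close> towards the
  pattern chosen in the block \<open>L y\<close>.\<close>

definition joined :: "colour \<Rightarrow> nat \<Rightarrow> nat \<Rightarrow> nat \<Rightarrow> bool" where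
  "joined c m y a \<longleftrightarrow> (\<exists>g\<in>choices. m = index g \<and> y \<in> V \<and> (\<exists>i<n. \<alpha> {i, n} = c \<and> a = g y i))"

definition Z' :: "nat set" where
  "Z' = (\<Union>x\<in>V. L x ` Z) \<union> (\<Union>g\<in>choices. R (index g) ` V)"

definition Q' :: "colour \<Rightarrow> nat \<Rightarrow> nat \<Rightarrow> bool" where
  "Q' c u v \<longleftrightarrow>
     (\<exists>x\<in>V. \<exists>a b. u = L x a \<and> v = L x b \<and> Q c a b) \<or>
     (\<exists>m\<in>index ` choices. \<exists>y z. u = R m y \<and> v = R m z \<and> P c y z) \<or>
     (\<exists>m y a. u = R m y \<and> v = L y a \<and> joined c m y a) \<or>
     (\<exists>m y a. u = L y a \<and> v = R m y \<and> joined c m y a)"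

definition \<P>' :: "(nat \<Rightarrow> nat) set" where
  "\<P>' = {L x \<circ> p | x p. x \<in> V \<and> p \<in> \<P>} \<union> {R (index g) | g. g \<in> choices}"

lemma Q'_simps [simp]:
  "Q' c (L x a) (L x' b) \<longleftrightarrow> x = x' \<and> x \<in> V \<and> Q c a b"
  "Q' c (R m y) (R m' z) \<longleftrightarrow> m = m' \<and> m \<in> index ` choices \<and> P c y z"
  "Q' c (R m y) (L x a) \<longleftrightarrow> x = y \<and> joined c m y a"
  "Q' c (L x a) (R m y) \<longleftrightarrow> x = y \<and> joined c m y a"
  by (auto simp: Q'_def)

lemma Q'_cases:
  assumes "Q' c u v"
  obtains (LL) x a b where "u = L x a" "v = L x b" "x \<in> V" "Q c a b"
    | (RR) m y z where "u = R m y" "v = R m z" "m \<in> index ` choices" "P c y z"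
    | (RL) m y a where "u = R m y" "v = L y a" "joined c m y a"
    | (LR) m y a where "u = L y a" "v = R m y" "joined c m y a"
  using assms unfolding Q'_def by (elim disjE bexE exE conjE) simp_all

lemma Q'_vertex: "Q' c u v \<Longrightarrow> (\<exists>x a. u = L x a) \<or> (\<exists>m y. u = R m y)"
  by (erule Q'_cases) blast+

lemma finV: "finite V" and finZ: "finite Z"
  using VP amalgam_graph[OF ZQ] by (auto simp: coloured_graph_def)

lemma P_graph: "P c u v \<Longrightarrow> u \<in> V \<and> v \<in> V \<and> u \<noteq> v \<and> P c v u" "P c u v \<Longrightarrow> P d u v \<Longrightarrow> c = d"
  using VP unfolding coloured_graph_def by blast+

lemma Q_graph: "Q c u v \<Longrightarrow> u \<in> Z \<and> v \<in> Z \<and> u \<noteq> v \<and> Q c v u" "Q c u v \<Longrightarrow> Q d u v \<Longrightarrow> c = d"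
proof -
  show "Q c u v \<Longrightarrow> u \<in> Z \<and> v \<in> Z \<and> u \<noteq> v \<and> Q c v u" "Q c u v \<Longrightarrow> Q d u v \<Longrightarrow> c = d"
    using amalgam_graph[OF ZQ] unfolding coloured_graph_def by blast+
qed

lemma finite_choices: "finite choices"
proof -
  have "finite ({..<n} \<rightarrow>\<^sub>E Z)" using finZ by (intro finite_PiE) auto
  then have "finite positions" unfolding positions_def by simp
  then show ?thesis unfolding choices_def using finV by (intro finite_PiE) auto
qed

lemma inj_index: "inj_on index choices"
  unfolding index_def using finite_imp_inj_to_nat_seg[OF finite_choices] someI_ex[of "\<lambda>h. inj_on h choices"] by blast

text \<open>The neighbours of a fixed \<open>R m y\<close> in the block \<open>L y\<close> are the
  points \<open>g y i\<close> of one pattern. \<open>\<iota>\<close> recovers the index from the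
  point, which is possible because \<open>Q\<close> has no loops.\<close>

lemma joined_index:
  obtains \<iota> where "\<And>c a. joined c m y a \<Longrightarrow> \<iota> a < n \<and> \<alpha> {\<iota> a, n} = c"
    and "\<And>c d a b. joined c m y a \<Longrightarrow> joined d m y b \<Longrightarrow> a \<noteq> b \<Longrightarrow> \<iota> a \<noteq> \<iota> b \<and> Q (\<alpha> {\<iota> a, \<iota> b}) a b"
    and "\<And>c a. joined c m y a \<Longrightarrow> a \<in> Z \<and> y \<in> V \<and> m \<in> index ` choices"
proof (cases "\<exists>g\<in>choices. m = index g \<and> y \<in> V")
  case False
  then have "\<not> joined c m y a" for c a by (auto simp: joined_def)
  then show ?thesis using that by blast
next
  case True
  then obtain g where g: "g \<in> choices" "m = index g" "y \<in> V" by blast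
  then have gy: "g y \<in> {..<n} \<rightarrow>\<^sub>E Z" "pattern_copy \<alpha> n Q (g y)"
    by (auto simp: choices_def positions_def PiE_def Pi_def)
  have neq: "Q (\<alpha> {i, j}) (g y i) (g y j)" if "i < n" "j < n" "i \<noteq> j" for i j
    using gy(2) that by (auto simp: pattern_copy_def)
  define \<iota> where "\<iota> a = (THE i. i < n \<and> a = g y i)" for a
  have \<iota>: "\<iota> (g y i) = i" if "i < n" for i
    unfolding \<iota>_def using that neq Q_graph(1) by (intro the_equality) metis+
  have j: "joined c m y a \<Longrightarrow> \<exists>i<n. \<alpha> {i, n} = c \<and> a = g y i" for c a
    using g inj_index by (auto simp: joined_def inj_on_def)
  show ?thesis
  proof (rule that[of \<iota>])
    fix c a assume "joined c m y a"
    with j \<iota> show "\<iota> a < n \<and> \<alpha> {\<iota> a, n} = c" by force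
    from j[OF \<open>joined c m y a\<close>] gy(1) g show "a \<in> Z \<and> y \<in> V \<and> m \<in> index ` choices" by auto
  next
    fix c d a b assume "joined c m y a" "joined d m y b" "a \<noteq> b"
    then obtain i i' where "i < n" "a = g y i" "i' < n" "b = g y i'" using j by metis
    then show "\<iota> a \<noteq> \<iota> b \<and> Q (\<alpha> {\<iota> a, \<iota> b}) a b" using \<iota> neq \<open>a \<noteq> b\<close> by auto
  qed
qed

lemma joined_vertex: "joined c m y a \<Longrightarrow> a \<in> Z \<and> y \<in> V \<and> m \<in> index ` choices"
  by (rule joined_index[of m y]) blast

lemma joined_unique: "joined c m y a \<Longrightarrow> joined d m y a \<Longrightarrow> c = d"
  by (rule joined_index[of m y]) metis

lemma step_graph: "coloured_graph Z' Q'"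
  unfolding coloured_graph_def
proof (intro conjI allI impI)
  show "finite Z'" using finV finZ finite_choices by (auto simp: Z'_def)
next
  fix c u v assume "Q' c u v"
  then have "u \<in> Z' \<and> v \<in> Z' \<and> u \<noteq> v \<and> Q' c v u"
  proof (cases rule: Q'_cases)
    case LL then show ?thesis using Q_graph(1)[OF LL(4)] by (auto simp: Z'_def)
  next
    case RR then show ?thesis using P_graph(1)[OF RR(4)] by (auto simp: Z'_def)
  next
    case RL then show ?thesis using joined_vertex[OF RL(3)] by (auto simp: Z'_def)
  next
    case LR then show ?thesis using joined_vertex[OF LR(3)] by (auto simp: Z'_def)
  qed
  then show "u \<in> Z'" "v \<in> Z'" "u \<noteq> v" "Q' c v u" by blast+
next
  fix c d u v assume "Q' c u v" "Q' d u v"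
  then show "c = d"
    using P_graph(2) Q_graph(2) joined_unique by (cases rule: Q'_cases) auto
qed

lemma step_copies: 
  assumes "p \<in> \<P>'"
  shows "inj_on p V" "p ` V \<subseteq> Z'" "P c u v \<Longrightarrow> Q' c (p u) (p v)"
proof -
  consider x q where "p = L x \<circ> q" "x \<in> V" "q \<in> \<P>" | g where "p = R (index g)" "g \<in> choices"
    using assms by (auto simp: \<P>'_def)
  then have "inj_on p V \<and> p ` V \<subseteq> Z' \<and> (P c u v \<longrightarrow> Q' c (p u) (p v))"
  proof cases
    case 1
    have q: "inj_on q V" "q ` V \<subseteq> Z" "P c u v \<Longrightarrow> Q c (q u) (q v)"
      using amalgam_copy[OF ZQ 1(3)] by simp_all
    have "p ` V \<subseteq> L x ` Z" unfolding 1(1) image_comp[symmetric] using q(2) by (rule image_mono)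
    also have "\<dots> \<subseteq> Z'" using 1(2) unfolding Z'_def by (intro le_supI1 UN_upper)
    finally have "p ` V \<subseteq> Z'" .
    moreover have "inj_on p V" unfolding 1(1) by (intro comp_inj_on q(1) inj_on_subset[OF inj_L]) simp
    ultimately show ?thesis using 1(1,2) q(3) by simp
  next
    case 2
    have "p ` V \<subseteq> Z'" unfolding Z'_def 2(1) by (intro le_supI2 UN_upper 2(2))
    moreover have "inj_on p V" unfolding 2(1) by (rule inj_on_subset[OF inj_R]) simp
    ultimately show ?thesis using 2 by auto
  qed
  then show "inj_on p V" "p ` V \<subseteq> Z'" "P c u v \<Longrightarrow> Q' c (p u) (p v)" by auto
qed

text \<open>\<open>S\<close> contains in each copy \<open>L x ` Z\<close> a pattern on \<open>n\<close> points, and these choices determine one of the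
  copies \<open>R m ` V\<close>; the vertex \<open>R m y\<close> in which \<open>S\<close> meets it extends the pattern in \<open>L y ` Z\<close>.\<close>
lemma step_hitting:
  assumes S: "\<And>p. p \<in> \<P>' \<Longrightarrow> S \<inter> p ` V \<noteq> {}"
  shows "\<exists>f. f ` {..<Suc n} \<subseteq> S \<inter> Z' \<and> pattern_copy \<alpha> (Suc n) Q' f \<and>
         (\<forall>p\<in>\<P>'. \<forall>i<Suc n. \<forall>j<Suc n. f i \<in> p ` V \<longrightarrow> f j \<in> p ` V \<longrightarrow> i = j)"
proof -
  have "\<exists>f. f ` {..<n} \<subseteq> L x -` S \<inter> Z \<and> pattern_copy \<alpha> n Q f \<and>
      (\<forall>p\<in>\<P>. \<forall>i<n. \<forall>j<n. f i \<in> p ` V \<longrightarrow> f j \<in> p ` V \<longrightarrow> i = j)" if "x \<in> V" for x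
  proof -
    have "L x -` S \<inter> p ` V \<noteq> {}" if "p \<in> \<P>" for p
    proof -
      have "S \<inter> (L x \<circ> p) ` V \<noteq> {}"
        using \<open>x \<in> V\<close> that by (intro S) (unfold \<P>'_def, blast)
      then show ?thesis by auto
    qed
    then show ?thesis by (rule amalgam_hitting[OF ZQ])
  qed
  then have "\<forall>x\<in>V. \<exists>f. f ` {..<n} \<subseteq> L x -` S \<inter> Z \<and> pattern_copy \<alpha> n Q f \<and>
      (\<forall>p\<in>\<P>. \<forall>i<n. \<forall>j<n. f i \<in> p ` V \<longrightarrow> f j \<in> p ` V \<longrightarrow> i = j)" by blast
  from bchoice[OF this] obtain F where
    F: "\<forall>x\<in>V. F x ` {..<n} \<subseteq> L x -` S \<inter> Z \<and> pattern_copy \<alpha> n Q (F x) \<and>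
      (\<forall>p\<in>\<P>. \<forall>i<n. \<forall>j<n. F x i \<in> p ` V \<longrightarrow> F x j \<in> p ` V \<longrightarrow> i = j)" ..
  have F1: "L x (F x i) \<in> S \<and> F x i \<in> Z" if "x \<in> V" "i < n" for x i
    using bspec[OF F that(1), THEN conjunct1] that(2) by auto
  have F2: "pattern_copy \<alpha> n Q (F x)" if "x \<in> V" for x
    using bspec[OF F that] by (elim conjE)
  have F3: "i = j" if "x \<in> V" "p \<in> \<P>" "i < n" "j < n" "F x i \<in> p ` V" "F x j \<in> p ` V" for x p i j
    using bspec[OF F that(1), THEN conjunct2, THEN conjunct2] that(2-) by blast
  define g where "g = (\<lambda>x\<in>V. restrict (F x) {..<n})"
  have "restrict (F x) {..<n} \<in> positions" if "x \<in> V" for x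
    using F1[OF that] F2[OF that] by (simp add: positions_def restrict_PiE_iff pattern_copy_def)
  then have g: "g \<in> choices" by (simp add: choices_def g_def restrict_PiE_iff)
  then have "R (index g) \<in> \<P>'" unfolding \<P>'_def by blast
  from S[OF this] obtain y where y: "y \<in> V" "R (index g) y \<in> S" by blast
  define f where "f i = (if i = n then R (index g) y else L y (F y i))" for i
  have joined: "joined (\<alpha> {i, n}) (index g) y (F y i)" if "i < n" for i
    unfolding joined_def
    by (intro bexI[OF _ g] conjI refl exI[of _ i] that y) (simp add: g_def y that)
  have "f ` {..<Suc n} \<subseteq> S \<inter> Z'"
    using y g F1[OF y(1)] by (auto simp: f_def Z'_def less_Suc_eq)
  moreover have "pattern_copy \<alpha> (Suc n) Q' f"
    using joined F2[OF y(1)] y by (auto simp: f_def pattern_copy_def less_Suc_eq insert_commute)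
  \<comment> \<open>A copy inside a block \<open>L x\<close> misses \<open>R (index g) y\<close>, so
    the old pattern in that block decides; a copy \<open>R m\<close> contains at most the last
    point.\<close>
  moreover have "i = j"
    if p: "p \<in> \<P>'" and ij: "i < Suc n" "j < Suc n" "f i \<in> p ` V" "f j \<in> p ` V" for p i j
  proof -
    consider x q where "p = L x \<circ> q" "x \<in> V" "q \<in> \<P>" | m where "p = R m"
      using p by (auto simp: \<P>'_def)
    then show ?thesis
    proof cases
      case 1
      then have "i < n" "j < n" "x = y" "F y i \<in> q ` V" "F y j \<in> q ` V"
        using ij by (auto simp: f_def less_Suc_eq split: if_splits)
      then show ?thesis using F3 y 1 by blast
    next
      case 2
      then show ?thesis using ij by (auto simp: f_def split: if_splits)
    qed
  qed
  ultimately show ?thesis by blast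
qed

text \<open>A clique inside one block is handled by the old amalgam, one inside a new copy by
  \<open>P\<close>. A mixed one has a single vertex \<open>R m y\<close>; the indices of its other
  vertices, together with \<open>n\<close>, form a clique of colour \<open>c\<close> in the
  pattern.\<close>

lemma step_clique:
  assumes s: "2 \<le> s" and K: "k_clique s (Q' c) K"
  shows "(\<exists>K. k_clique s (P c) K) \<or> (\<exists>K\<subseteq>{..<Suc n}. k_clique s (\<lambda>i j. \<alpha> {i, j} = c) K)"
proof -
  have adj: "Q' c u v" if "u \<in> K" "v \<in> K" "u \<noteq> v" for u v
    using K that by (auto simp: k_clique_def pairwise_def)
  have vertex: "(\<exists>x a. u = L x a) \<or> (\<exists>m y. u = R m y)" if "u \<in> K" for u
    using Q'_vertex k_clique_imp_neighbour[OF K s that] by blast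
  have "K \<noteq> {}" using K s by (auto simp: k_clique_def)
  obtain u0 where "u0 \<in> K" using \<open>K \<noteq> {}\<close> by blast
  consider x a where "L x a \<in> K" "\<And>m y. R m y \<notin> K" | m y where "R m y \<in> K" "\<And>x a. L x a \<notin> K"
    | m y x a where "R m y \<in> K" "L x a \<in> K"
    using vertex[OF \<open>u0 \<in> K\<close>] \<open>u0 \<in> K\<close> by blast
  then show ?thesis
  proof cases
    case 1
    have range: "K \<subseteq> range (L x)"
    proof
      fix u assume u: "u \<in> K"
      obtain x' b where ub: "u = L x' b" using vertex[OF u] 1(2) u by blast
      then have "x' = x" using adj[OF u 1(1)] by (cases "u = L x a") auto
      then show "u \<in> range (L x)" using ub by simp
    qed
    have "k_clique s (Q c) (L x -` K)"
      by (rule k_clique_preimage[OF K _ range]) simp_all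
    moreover have "{..<n} \<subseteq> {..<Suc n}" by auto
    ultimately show ?thesis using amalgam_clique[OF ZQ s] by (meson subset_trans)
  next
    case 2
    have range: "K \<subseteq> range (R m)"
    proof
      fix u assume u: "u \<in> K"
      obtain m' b where ub: "u = R m' b" using vertex[OF u] 2(2) u by blast
      then have "m' = m" using adj[OF u 2(1)] by (cases "u = R m y") auto
      then show "u \<in> range (R m)" using ub by simp
    qed
    have "k_clique s (P c) (R m -` K)"
      by (rule k_clique_preimage[OF K _ range]) simp_all
    then show ?thesis by blast
  next
    case 3
    obtain \<iota> where \<iota>: "\<And>c a. joined c m y a \<Longrightarrow> \<iota> a < n \<and> \<alpha> {\<iota> a, n} = c"
      and \<iota>2: "\<And>c d a b. joined c m y a \<Longrightarrow> joined d m y b \<Longrightarrow> a \<noteq> b \<Longrightarrow> \<iota> a \<noteq> \<iota> b \<and> Q (\<alpha> {\<iota> a, \<iota> b}) a b"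
      and "\<And>c a. joined c m y a \<Longrightarrow> a \<in> Z \<and> y \<in> V \<and> m \<in> index ` choices"
      by (rule joined_index[of m y]) (rule that)
    have J: "x' = y \<and> joined c m y b" if "L x' b \<in> K" for x' b
      using adj[OF 3(1) that] by simp
    \<comment> \<open>Adjacent vertices of new copies share \<open>m\<close>, and the common
      neighbour \<open>L x a\<close> lies in block \<open>y\<close> as well as in block
      \<open>y'\<close>.\<close>
    have one: "m' = m \<and> y' = y" if "R m' y' \<in> K" for m' y'
      using adj[OF that 3(1)] adj[OF that 3(2)] J[OF 3(2)] by (cases "R m' y' = R m y") auto
    define K0 where "K0 = L y -` K"
    have K_eq: "K = insert (R m y) (L y ` K0)"
    proof (intro subset_antisym subsetI)
      fix u assume "u \<in> K"
      from vertex[OF this] show "u \<in> insert (R m y) (L y ` K0)"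
      proof (elim disjE exE)
        fix x' b assume "u = L x' b"
        with J \<open>u \<in> K\<close> have "u = L y b" by simp
        with \<open>u \<in> K\<close> show ?thesis by (simp add: K0_def)
      next
        fix m' y' assume "u = R m' y'"
        with one \<open>u \<in> K\<close> show ?thesis by simp
      qed
    qed (use 3(1) in \<open>auto simp: K0_def\<close>)
    have fin: "finite K0" unfolding K0_def using K by (intro finite_vimageI inj_L) (simp add: k_clique_def)
    have J0: "joined c m y a" if "a \<in> K0" for a using J[of y a] that by (simp add: K0_def)
    have Q0: "Q c a b" if "a \<in> K0" "b \<in> K0" "a \<noteq> b" for a b
      using adj[of "L y a" "L y b"] that by (simp add: K0_def)
    have inj: "inj_on \<iota> K0"
    proof (rule inj_onI)
      fix a b assume "a \<in> K0" "b \<in> K0" "\<iota> a = \<iota> b"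
      then show "a = b" using \<iota>2[OF J0 J0, of a b] by blast
    qed
    have lt: "\<iota> a < n" and last: "\<alpha> {\<iota> a, n} = c" if "a \<in> K0" for a
      using \<iota>[OF J0[OF that]] by auto
    have mid: "\<alpha> {\<iota> a, \<iota> b} = c" if "a \<in> K0" "b \<in> K0" "\<iota> a \<noteq> \<iota> b" for a b
    proof -
      have "a \<noteq> b" using that by auto
      have "Q (\<alpha> {\<iota> a, \<iota> b}) a b" using \<iota>2[OF J0[OF that(1)] J0[OF that(2)] \<open>a \<noteq> b\<close>] by simp
      from Q_graph(2)[OF this Q0[OF that(1,2) \<open>a \<noteq> b\<close>]] show ?thesis .
    qed
    let ?I = "insert n (\<iota> ` K0)"
    have "n \<notin> \<iota> ` K0" using lt by blast
    moreover have "R m y \<notin> L y ` K0" by auto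
    moreover have "card (L y ` K0) = card K0" by (rule card_image) (auto simp: inj_on_def)
    ultimately have "card ?I = s"
      using K fin card_image[OF inj] by (simp add: k_clique_def K_eq)
    moreover have "pairwise (\<lambda>i j. \<alpha> {i, j} = c) ?I"
      using mid last by (auto simp: pairwise_insert pairwise_def insert_commute)
    ultimately have "k_clique s (\<lambda>i j. \<alpha> {i, j} = c) ?I" using fin by (simp add: k_clique_def)
    moreover have "?I \<subseteq> {..<Suc n}" using lt by (auto simp: less_Suc_eq)
    ultimately show ?thesis by blast
  qed
qed

text \<open>Unless \<open>c\<close> occurs on a pair \<open>{i, n}\<close>, no edge of colour
  \<open>c\<close> joins a block to a new copy, and then clique and pendent edge stay inside one of
  them.\<close>

lemma step_pendent:
  assumes k: "2 \<le> k" and pen: "has_pendent k (Q' c)"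
  shows "has_pendent k (P c) \<or> (\<exists>i<Suc n. \<exists>j<Suc n. i \<noteq> j \<and> \<alpha> {i, j} = c)"
proof (cases "\<exists>i<n. \<alpha> {i, n} = c")
  case True
  then show ?thesis by (metis less_SucI lessI less_irrefl)
next
  case False
  then have no: "\<not> joined c m y a" for m y a by (auto simp: joined_def)
  obtain K u w where K: "k_clique k (Q' c) K" and uw: "u \<in> K" "w \<notin> K" "Q' c u w"
    using pen by (auto simp: has_pendent_def)
  have adj: "Q' c u v" if "v \<in> K" "v \<noteq> u" for v
    using K that uw by (auto simp: k_clique_def pairwise_def)
  from Q'_vertex[OF uw(3)] show ?thesis
  proof (elim disjE exE)
    fix x a assume u: "u = L x a"
    have range: "v \<in> range (L x)" if "Q' c u v" for v
      using that u no by (auto simp: Q'_def)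
    have "v \<in> range (L x)" if "v \<in> K" for v
      using range[OF adj[OF that]] u by (cases "v = u") auto
    then have "K \<subseteq> range (L x)" by (rule subsetI)
    then have "k_clique k (Q c) (L x -` K)"
      by (rule k_clique_preimage[OF K, rotated]) (simp_all)
    moreover obtain b where "w = L x b" using range[OF uw(3)] by blast
    ultimately have "has_pendent k (Q c)"
      using uw u by (intro has_pendentI[of k _ "L x -` K" a b]) auto
    then show ?thesis using amalgam_pendent[OF ZQ k] by (meson less_SucI)
  next
    fix m y assume u: "u = R m y"
    have range: "v \<in> range (R m)" if "Q' c u v" for v
      using that u no by (auto simp: Q'_def)
    have "v \<in> range (R m)" if "v \<in> K" for v
      using range[OF adj[OF that]] u by (cases "v = u") auto
    then have "K \<subseteq> range (R m)" by (rule subsetI)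
    then have "k_clique k (P c) (R m -` K)"
      by (rule k_clique_preimage[OF K, rotated]) (simp_all)
    moreover obtain b where "w = R m b" using range[OF uw(3)] by blast
    ultimately have "has_pendent k (P c)"
      using uw u by (intro has_pendentI[of k _ "R m -` K" y b]) auto
    then show ?thesis by blast
  qed
qed

lemma step_amalgam: "amalgam V P \<alpha> (Suc n) Z' Q' \<P>'"
  unfolding amalgam_def
proof (intro conjI allI impI ballI)
  fix S assume "\<forall>p\<in>\<P>'. S \<inter> p ` V \<noteq> {}"
  then show "\<exists>f. f ` {..<Suc n} \<subseteq> S \<inter> Z' \<and> pattern_copy \<alpha> (Suc n) Q' f \<and>
      (\<forall>p\<in>\<P>'. \<forall>i<Suc n. \<forall>j<Suc n. f i \<in> p ` V \<longrightarrow> f j \<in> p ` V \<longrightarrow> i = j)"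
    by (intro step_hitting) blast
next
  fix c s K assume "2 \<le> s" "k_clique s (Q' c) K"
  then show "(\<exists>K. k_clique s (P c) K) \<or> (\<exists>K\<subseteq>{..<Suc n}. k_clique s (\<lambda>i j. \<alpha> {i, j} = c) K)"
    by (rule step_clique)
next
  fix c k assume "2 \<le> k" "has_pendent k (Q' c)"
  then show "has_pendent k (P c) \<or> (\<exists>i<Suc n. \<exists>j<Suc n. i \<noteq> j \<and> \<alpha> {i, j} = c)"
    by (rule step_pendent)
qed (simp_all add: step_graph step_copies)

end

lemma no_edge_no_clique: "2 \<le> s \<Longrightarrow> \<not> k_clique s (\<lambda>u v. False) K"
proof
  assume s: "2 \<le> s" and K: "k_clique s (\<lambda>u v. False) K"
  then obtain u where "u \<in> K" by (cases "K = {}") (auto simp: k_clique_def)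
  then show False using k_clique_imp_neighbour[OF K s] by simp
qed

lemma amalgam_exists:
  assumes "coloured_graph V P" "V \<noteq> {}"
  shows "\<exists>Z Q \<P>. amalgam V P \<alpha> n Z Q \<P>"
proof (induction n)
  case 0
  \<comment> \<open>The hitting condition here asks only for a pattern on 0 points, which any
    function is.\<close>
  have "amalgam V P \<alpha> 0 {} (\<lambda>_ _ _. False) {}"
    by (simp add: amalgam_def coloured_graph_def pattern_copy_def has_pendent_def no_edge_no_clique)
  then show ?case by blast
next
  case (Suc n)
  then obtain Z Q \<P> where "amalgam V P \<alpha> n Z Q \<P>" by blast
  then interpret amalgam_step V P \<alpha> n Z Q \<P> using assms by unfold_locales
  show ?case using step_amalgam by blast
qed

subsection \<open>Ramsey numbers and a vertex Ramsey graph\<close>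

text \<open>The classical n -> (a, b), with red first.\<close>

definition arrows :: "nat \<Rightarrow> nat \<Rightarrow> nat \<Rightarrow> bool" where
  "arrows n a b \<longleftrightarrow> (\<forall>\<chi> :: nat set \<Rightarrow> colour.
     (\<exists>K\<subseteq>{..<n}. k_clique a (\<lambda>x y. \<chi> {x, y} = Red) K) \<or>
     (\<exists>K\<subseteq>{..<n}. k_clique b (\<lambda>x y. \<chi> {x, y} = Blue) K))"

lemma opp_eq_simps [simp]: "opp c = Red \<longleftrightarrow> c = Blue" "opp c = Blue \<longleftrightarrow> c = Red"
  by (cases c; simp)+

lemma arrows_commute: "arrows n a b \<Longrightarrow> arrows n b a"
  unfolding arrows_def
proof
  fix \<chi> :: "nat set \<Rightarrow> colour"
  assume "\<forall>\<chi> :: nat set \<Rightarrow> colour. (\<exists>K\<subseteq>{..<n}. k_clique a (\<lambda>x y. \<chi> {x, y} = Red) K) \<or>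
     (\<exists>K\<subseteq>{..<n}. k_clique b (\<lambda>x y. \<chi> {x, y} = Blue) K)"
  from spec[OF this, of "\<lambda>e. opp (\<chi> e)"]
  show "(\<exists>K\<subseteq>{..<n}. k_clique b (\<lambda>x y. \<chi> {x, y} = Red) K) \<or>
     (\<exists>K\<subseteq>{..<n}. k_clique a (\<lambda>x y. \<chi> {x, y} = Blue) K)"
    by (simp add: disj_commute)
qed

lemma k_clique_remove:
  assumes "k_clique (Suc s) r K"
  shows "x \<in> K \<Longrightarrow> k_clique s r (K - {x})" and "\<exists>x. x \<in> K"
proof -
  show "k_clique s r (K - {x})" if "x \<in> K"
    using assms that by (auto simp: k_clique_def intro: pairwise_subset)
  have "K \<noteq> {}" using assms by (auto simp: k_clique_def)
  then show "\<exists>x. x \<in> K" by blast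
qed

lemma arrows_exists: "\<exists>n. arrows n a b"
proof -
  obtain r where r: "\<And>V :: nat set. \<And>E. finite V \<Longrightarrow> r \<le> card V \<Longrightarrow>
      \<exists>R\<subseteq>V. card R = a \<and> clique R E \<or> card R = b \<and> indep R E"
    using ramsey2[of a b] by blast
  have "(\<exists>K\<subseteq>{..<r}. k_clique a (\<lambda>x y. \<chi> {x, y} = Red) K) \<or>
     (\<exists>K\<subseteq>{..<r}. k_clique b (\<lambda>x y. \<chi> {x, y} = Blue) K)" for \<chi> :: "nat set \<Rightarrow> colour"
  proof -
    obtain K where K: "K \<subseteq> {..<r}" "card K = a \<and> clique K {e. \<chi> e = Red} \<or> card K = b \<and> indep K {e. \<chi> e = Red}"
      using r[of "{..<r}" "{e. \<chi> e = Red}"] by auto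
    then have "finite K" by (meson finite_lessThan finite_subset)
    moreover have "\<chi> e \<noteq> Red \<longleftrightarrow> \<chi> e = Blue" for e by (cases "\<chi> e") auto
    ultimately show ?thesis
      using K by (auto simp: clique_def indep_def k_clique_def pairwise_def)
  qed
  then show ?thesis by (auto simp: arrows_def)
qed

text \<open>Extend a colouring of \<open>{..<n}\<close> by a vertex all of whose edges are red.\<close>
lemma arrows_Suc:
  assumes "arrows (Suc n) (Suc a) b" "b \<ge> 2"
  shows "arrows n a b"
  unfolding arrows_def
proof
  fix \<chi> :: "nat set \<Rightarrow> colour"
  define \<chi>' where "\<chi>' e = (if n \<in> e then Red else \<chi> e)" for e
  have sub: "K \<subseteq> {..<n}" if "K \<subseteq> {..<Suc n}" "n \<notin> K" for K
    using that by (auto simp: less_Suc_eq)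
  have restr: "k_clique s (\<lambda>x y. \<chi> {x, y} = c) K" if "k_clique s (\<lambda>x y. \<chi>' {x, y} = c) K" "n \<notin> K" for s c K
    unfolding k_clique_def
  proof (intro conjI pairwiseI)
    fix x y assume xy: "x \<in> K" "y \<in> K" "x \<noteq> y"
    then have "n \<notin> {x, y}" using that(2) by auto
    moreover have "\<chi>' {x, y} = c" using that(1) xy by (simp add: k_clique_def pairwise_def)
    ultimately show "\<chi> {x, y} = c" by (simp only: \<chi>'_def if_False)
  qed (use that(1) in \<open>simp_all add: k_clique_def\<close>)
  from assms(1) consider K where "K \<subseteq> {..<Suc n}" "k_clique (Suc a) (\<lambda>x y. \<chi>' {x, y} = Red) K"
    | K where "K \<subseteq> {..<Suc n}" "k_clique b (\<lambda>x y. \<chi>' {x, y} = Blue) K"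
    unfolding arrows_def by blast
  then show "(\<exists>K\<subseteq>{..<n}. k_clique a (\<lambda>x y. \<chi> {x, y} = Red) K) \<or>
     (\<exists>K\<subseteq>{..<n}. k_clique b (\<lambda>x y. \<chi> {x, y} = Blue) K)"
  proof cases
    case 1
    \<comment> \<open>\<open>n\<close> is removed if present, any vertex otherwise.\<close>
    obtain x where x: "x \<in> K" "n \<notin> K - {x}"
      using k_clique_remove(2)[OF 1(2)] by (cases "n \<in> K") auto
    have "k_clique a (\<lambda>x y. \<chi> {x, y} = Red) (K - {x})"
      using restr[OF k_clique_remove(1)[OF 1(2) x(1)] x(2)] .
    moreover have "K - {x} \<subseteq> {..<n}" using 1(1) x(2) by (intro sub) auto
    ultimately show ?thesis by blast
  next
    case 2
    \<comment> \<open>The vertex \<open>n\<close> has no blue edge, while \<open>b \<ge> 2\<close>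
      gives each member of \<open>K\<close> one.\<close>
    have "n \<notin> K"
    proof
      assume "n \<in> K"
      from k_clique_imp_neighbour[OF 2(2) assms(2) this] show False by (auto simp: \<chi>'_def)
    qed
    then show ?thesis using restr[OF 2(2)] sub[OF 2(1)] by blast
  qed
qed

lemma pattern_copy_image:
  assumes "pattern_copy \<alpha> n P e" "\<And>c u v. P c u v \<Longrightarrow> Q c (p u) (p v)"
  shows "pattern_copy \<alpha> n Q (p \<circ> e)"
  using assms by (simp add: pattern_copy_def)

text \<open>Induction on \<open>C\<close>: amalgamate copies of the graph for \<open>C\<close> along
  \<open>\<alpha>\<close>. In a colouring with one more colour \<open>c\<close>, either some copy
  avoids \<open>c\<close> and the induction hypothesis applies there, or the class of
  \<open>c\<close> meets every copy and the amalgam puts a pattern into it.\<close>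

lemma vertex_ramsey:
  assumes "finite C" "n > 0"
  shows "\<exists>V P. coloured_graph V P \<and> V \<noteq> {} \<and>
    (\<forall>c s K. 2 \<le> s \<longrightarrow> k_clique s (P c) K \<longrightarrow> (\<exists>K\<subseteq>{..<n}. k_clique s (\<lambda>i j. \<alpha> {i, j} = c) K)) \<and>
    (\<forall>f :: nat \<Rightarrow> 'b. f ` V \<subseteq> C \<longrightarrow>
      (\<exists>e d. e ` {..<n} \<subseteq> V \<and> pattern_copy \<alpha> n P e \<and> (\<forall>i<n. f (e i) = d)))"
  using assms(1)
proof (induction C rule: finite_induct)
  case empty
  \<comment> \<open>A nonempty vertex set admits no colouring by the empty set.\<close>
  show ?case
    by (rule exI[of _ "{0}"], rule exI[of _ "\<lambda>_ _ _. False"])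
      (simp add: coloured_graph_def no_edge_no_clique)
next
  case (insert c C)
  from insert.IH obtain V P where VP: "coloured_graph V P \<and> V \<noteq> {} \<and>
    (\<forall>c s K. 2 \<le> s \<longrightarrow> k_clique s (P c) K \<longrightarrow> (\<exists>K\<subseteq>{..<n}. k_clique s (\<lambda>i j. \<alpha> {i, j} = c) K)) \<and>
    (\<forall>f :: nat \<Rightarrow> 'b. f ` V \<subseteq> C \<longrightarrow>
      (\<exists>e d. e ` {..<n} \<subseteq> V \<and> pattern_copy \<alpha> n P e \<and> (\<forall>i<n. f (e i) = d)))"
    by (elim exE)
  note V = VP[THEN conjunct1] VP[THEN conjunct2, THEN conjunct1]
  have cl: "\<exists>K\<subseteq>{..<n}. k_clique s (\<lambda>i j. \<alpha> {i, j} = c) K" if "2 \<le> s" "k_clique s (P c) K" for c s K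
    using VP[THEN conjunct2, THEN conjunct2, THEN conjunct1, rule_format, OF that] .
  have mono: "\<exists>e d. e ` {..<n} \<subseteq> V \<and> pattern_copy \<alpha> n P e \<and> (\<forall>i<n. f (e i) = d)"
    if "f ` V \<subseteq> C" for f :: "nat \<Rightarrow> 'b"
    using VP[THEN conjunct2, THEN conjunct2, THEN conjunct2] that by simp
  from amalgam_exists[OF V] obtain Z Q \<P> where Z: "amalgam V P \<alpha> n Z Q \<P>" by blast
  have "\<exists>e d. e ` {..<n} \<subseteq> Z \<and> pattern_copy \<alpha> n Q e \<and> (\<forall>i<n. f (e i) = d)"
    if f: "f ` Z \<subseteq> insert c C" for f :: "nat \<Rightarrow> 'b"
  proof (cases "\<exists>p\<in>\<P>. \<forall>v\<in>V. f (p v) \<noteq> c")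
    case True
    then obtain p where p: "p \<in> \<P>" "\<And>v. v \<in> V \<Longrightarrow> f (p v) \<noteq> c" by blast
    have pZ: "p ` V \<subseteq> Z" and pP: "\<And>c u v. P c u v \<Longrightarrow> Q c (p u) (p v)"
      using amalgam_copy[OF Z p(1)] by simp_all
    have "(f \<circ> p) ` V \<subseteq> C" using f pZ p(2) by fastforce
    from mono[OF this] obtain e d where e: "e ` {..<n} \<subseteq> V" "pattern_copy \<alpha> n P e" "\<forall>i<n. f (p (e i)) = d"
      by auto
    have "(p \<circ> e) ` {..<n} \<subseteq> Z" using e(1) pZ by auto
    moreover have "pattern_copy \<alpha> n Q (p \<circ> e)" using e(2) pP by (rule pattern_copy_image)
    ultimately show ?thesis using e(3) by (intro exI[of _ "p \<circ> e"] exI[of _ d]) simp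
  next
    case False
    then have "{x. f x = c} \<inter> p ` V \<noteq> {}" if "p \<in> \<P>" for p using that by blast
    from amalgam_hitting[OF Z this] obtain e where e: "e ` {..<n} \<subseteq> {x. f x = c} \<inter> Z" "pattern_copy \<alpha> n Q e"
      by blast
    then show ?thesis by (intro exI[of _ e] exI[of _ c]) auto
  qed
  moreover have "\<exists>K\<subseteq>{..<n}. k_clique s (\<lambda>i j. \<alpha> {i, j} = c) K" if "2 \<le> s" "k_clique s (Q c) K" for c s K
    using amalgam_clique[OF Z that] cl[OF that(1)] by blast
  moreover have "Z \<noteq> {}"
  proof -
    have "UNIV \<inter> p ` V \<noteq> {}" for p using V(2) by simp
    from amalgam_hitting[OF Z this] obtain e where "e ` {..<n} \<subseteq> UNIV \<inter> Z" by blast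
    then have "e 0 \<in> Z" using assms(2) by auto
    then show ?thesis by blast
  qed
  ultimately show ?case using amalgam_graph[OF Z] by (intro exI[of _ Z] exI[of _ Q] conjI) auto
qed

subsection \<open>A graph that is Ramsey for the clique only\<close>

text \<open>The graph without its colours is Ramsey for the complete graph on \<open>k\<close>
  vertices, while the colouring \<open>P\<close> has no blue one and lets no red edge leave a red
  one.\<close>

definition clique_forcing :: "nat \<Rightarrow> nat set \<Rightarrow> (colour \<Rightarrow> nat \<Rightarrow> nat \<Rightarrow> bool) \<Rightarrow> bool" where
  "clique_forcing k V P \<longleftrightarrow> coloured_graph V P \<and> V \<noteq> {} \<and>
     (\<forall>K. \<not> k_clique k (P Blue) K) \<and> \<not> has_pendent k (P Red) \<and>
     (\<forall>\<chi> :: nat set \<Rightarrow> colour. \<exists>c K. K \<subseteq> V \<and> k_clique k (\<lambda>u v. (\<exists>d. P d u v) \<and> \<chi> {u, v} = c) K)"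

text \<open>In \<open>mono\<close> the colours are the subsets of \<open>T\<close>; the subset
  assigned to a vertex of \<open>Y\<close> will be its red neighbours in \<open>T\<close>.\<close>

locale clique_join =
  fixes k n :: nat and \<alpha> :: "nat set \<Rightarrow> colour" and Y :: "nat set" and P :: "colour \<Rightarrow> nat \<Rightarrow> nat \<Rightarrow> bool"
    and T :: "nat set"
  assumes k: "k \<ge> 3"
    and arrows1: "arrows n (k - 1) (k - 1)" and arrows2: "arrows n k (k - 2)"
    and Y: "coloured_graph Y P"
    and no_red: "\<not> k_clique k (P Red) K" and no_blue: "\<not> k_clique (k - 1) (P Blue) K"
    and mono: "\<And>f :: nat \<Rightarrow> nat set. f ` Y \<subseteq> Pow T \<Longrightarrow>
      \<exists>e D. e ` {..<n} \<subseteq> Y \<and> pattern_copy \<alpha> n P e \<and> (\<forall>i<n. f (e i) = D)"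
    and T: "finite T" "card T = k" "T \<inter> Y = {}"
begin

definition P' :: "colour \<Rightarrow> nat \<Rightarrow> nat \<Rightarrow> bool" where
  "P' c u v \<longleftrightarrow> P c u v \<or> c = Red \<and> u \<in> T \<and> v \<in> T \<and> u \<noteq> v \<or>
     c = Blue \<and> (u \<in> T \<and> v \<in> Y \<or> u \<in> Y \<and> v \<in> T)"

lemma P_Y: "P c u v \<Longrightarrow> u \<in> Y \<and> v \<in> Y \<and> u \<noteq> v \<and> P c v u"
  using Y unfolding coloured_graph_def by blast

lemma P_unique: "P c u v \<Longrightarrow> P d u v \<Longrightarrow> c = d"
  using Y unfolding coloured_graph_def by blast

lemma TY: "x \<in> T \<Longrightarrow> x \<notin> Y" "x \<in> Y \<Longrightarrow> x \<notin> T"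
  using T by auto

lemma join_graph: "coloured_graph (Y \<union> T) P'"
  unfolding coloured_graph_def
proof (intro conjI allI impI)
  show "finite (Y \<union> T)" using Y T by (simp add: coloured_graph_def)
next
  fix c u v assume "P' c u v"
  then show "u \<in> Y \<union> T" "v \<in> Y \<union> T" "u \<noteq> v" "P' c v u"
    unfolding P'_def using P_Y[of c u v] TY[of u] TY[of v] by auto
next
  fix c d u v assume "P' c u v" "P' d u v"
  then show "c = d"
    unfolding P'_def using P_Y[of c u v] P_Y[of d u v] P_unique[of c u v d] TY[of u] TY[of v] by auto
qed

text \<open>The edges in \<open>T\<close> are red, so a blue clique has at most one vertex there;
  dropping it leaves a blue clique on \<open>k - 1\<close> vertices, forbidden in
  \<open>Y\<close>.\<close>

lemma join_no_blue: "\<not> k_clique k (P' Blue) K"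
proof
  assume K: "k_clique k (P' Blue) K"
  then have K1: "k_clique (Suc (k - 1)) (P' Blue) K" using k by simp
  have "\<exists>x\<in>K. \<forall>y\<in>K - {x}. y \<notin> T"
  proof (cases "K \<inter> T = {}")
    case True
    then show ?thesis using k_clique_remove(2)[OF K1] by blast
  next
    case False
    then obtain x where x: "x \<in> K" "x \<in> T" by blast
    have "y \<notin> T" if "y \<in> K" "y \<noteq> x" for y
    proof -
      have "P' Blue x y" using K x that by (simp add: k_clique_def pairwise_def)
      then show ?thesis using x P_Y[of Blue x y] TY[of x] TY[of y] by (auto simp: P'_def)
    qed
    then show ?thesis using x by blast
  qed
  then obtain x where x: "x \<in> K" "\<And>y. y \<in> K - {x} \<Longrightarrow> y \<notin> T" by blast
  from k_clique_remove(1)[OF K1 x(1)] have "k_clique (k - 1) (P' Blue) (K - {x})" .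
  then have "k_clique (k - 1) (P Blue) (K - {x})"
    using x(2) unfolding k_clique_def pairwise_def P'_def by blast
  then show False using no_blue by blast
qed

text \<open>No red edge joins \<open>T\<close> to \<open>Y\<close>. A red clique on \<open>k\<close>
  vertices cannot lie in \<open>Y\<close>, so it is all of \<open>T\<close>, and nothing red leaves
  it.\<close>

lemma join_no_pendent: "\<not> has_pendent k (P' Red)"
proof
  assume "has_pendent k (P' Red)"
  then obtain K u w where K: "k_clique k (P' Red) K" and uw: "u \<in> K" "w \<notin> K" "P' Red u w"
    by (rule has_pendentE)
  have adj: "P' Red x y" if "x \<in> K" "y \<in> K" "x \<noteq> y" for x y
    using K that by (simp add: k_clique_def pairwise_def)
  show False
  proof (cases "u \<in> T")
    case True
    have red: "v \<in> T" if "P' Red u v" for v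
      using that True P_Y[of Red u v] TY[of u] by (auto simp: P'_def)
    have "K \<subseteq> T" using red[OF adj[OF uw(1)]] True by blast
    then have "K = T" using K T by (intro card_subset_eq) (auto simp: k_clique_def)
    then show False using red[OF uw(3)] uw(2) by blast
  next
    case False
    have "x \<notin> T" if "x \<in> K" for x
      using adj[OF that uw(1)] False P_Y[of Red x u] TY[of x] by (cases "x = u") (auto simp: P'_def)
    then have "k_clique k (P Red) K"
      using K unfolding k_clique_def pairwise_def P'_def by blast
    then show False using no_red by blast
  qed
qed

text \<open>Unless \<open>T\<close> is monochromatic, both colours occur in it. Some pattern in
  \<open>Y\<close> sees \<open>T\<close> uniformly. If it sends both colours to \<open>T\<close>, a
  monochromatic clique on \<open>k - 1\<close> of its points extends by one vertex of
  \<open>T\<close>. If it sends only \<open>c\<close>, it has a clique of colour \<open>c\<close> on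
  \<open>k - 2\<close> points, which extends by an edge of colour \<open>c\<close> in
  \<open>T\<close>, or a clique on \<open>k\<close> points in the other colour.\<close>

lemma join_forcing:
  fixes \<chi> :: "nat set \<Rightarrow> colour"
  shows "\<exists>c K. K \<subseteq> Y \<union> T \<and> k_clique k (\<lambda>u v. (\<exists>d. P' d u v) \<and> \<chi> {u, v} = c) K"
proof -
  have T_adj: "\<exists>d. P' d s t" if "s \<in> T" "t \<in> T" "s \<noteq> t" for s t
    using that unfolding P'_def by blast
  show ?thesis
  proof (cases "\<exists>c. \<forall>s\<in>T. \<forall>t\<in>T. s \<noteq> t \<longrightarrow> \<chi> {s, t} = c")
    case True
    then obtain c where "\<forall>s\<in>T. \<forall>t\<in>T. s \<noteq> t \<longrightarrow> \<chi> {s, t} = c" ..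
    then have "k_clique k (\<lambda>u v. (\<exists>d. P' d u v) \<and> \<chi> {u, v} = c) T"
      using T T_adj by (simp add: k_clique_def pairwise_def)
    then show ?thesis by blast
  next
    case False
    have edge: "\<exists>s\<in>T. \<exists>t\<in>T. s \<noteq> t \<and> \<chi> {s, t} = c" for c
    proof -
      have "x \<noteq> opp c \<longleftrightarrow> x = c" for x by (cases x; cases c) auto
      then show ?thesis using spec[OF False[unfolded not_ex], of "opp c"] by simp
    qed
    have "(\<lambda>x. {t \<in> T. \<chi> {x, t} = Red}) ` Y \<subseteq> Pow T" by blast
    from mono[OF this] obtain e D where e: "e ` {..<n} \<subseteq> Y" "pattern_copy \<alpha> n P e"
      and D: "\<forall>i<n. {t \<in> T. \<chi> {e i, t} = Red} = D" by blast
    have e_adj: "P (\<alpha> {i, j}) (e i) (e j)" if "i < n" "j < n" "i \<noteq> j" for i j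
      using e(2) that by (simp add: pattern_copy_def)
    have inj: "inj_on e {..<n}"
    proof (rule inj_onI, rule ccontr)
      fix i j assume "i \<in> {..<n}" "j \<in> {..<n}" "e i = e j" "i \<noteq> j"
      then show False using e_adj[of i j] P_Y[of _ "e i" "e j"] by auto
    qed
    have eY: "e i \<in> Y" if "i < n" for i using e(1) that by blast
    \<comment> \<open>Cliques are found on the indices, coloured by pulling \<open>\<chi>\<close>
      back along \<open>e\<close>, and then carried into \<open>Y\<close>.\<close>
    have build: ?thesis
      if K: "K \<subseteq> {..<n}" "k_clique a (\<lambda>i j. \<chi> (e ` {i, j}) = c) K" and U: "U \<subseteq> T" "a + card U = k"
        and cU: "\<And>s t. s \<in> U \<Longrightarrow> t \<in> U \<Longrightarrow> s \<noteq> t \<Longrightarrow> \<chi> {s, t} = c"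
        and cKU: "\<And>i t. i < n \<Longrightarrow> t \<in> U \<Longrightarrow> \<chi> {e i, t} = c" for K a c U
    proof -
      have "finite U" using U T finite_subset by blast
      have eK: "e ` K \<subseteq> Y" using K(1) e(1) by auto
      have dis: "e ` K \<inter> U = {}" using eK U(1) T(3) by auto
      have "card (e ` K) = a" using K card_image[OF inj_on_subset[OF inj K(1)]] by (simp add: k_clique_def)
      then have card: "card (e ` K \<union> U) = k"
        using card_Un_disjoint[of "e ` K" U] K(2) dis U(2) \<open>finite U\<close> by (simp add: k_clique_def)
      let ?A = "\<lambda>u v. (\<exists>d. P' d u v) \<and> \<chi> {u, v} = c"
      have KK: "?A (e i) (e j)" if "i \<in> K" "j \<in> K" "e i \<noteq> e j" for i j
      proof
        have ij: "i < n" "j < n" "i \<noteq> j" using K(1) that by auto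
        show "\<exists>d. P' d (e i) (e j)" unfolding P'_def using e_adj[OF ij] by blast
        have "\<chi> (e ` {i, j}) = c" using K(2) that(1,2) ij(3) by (simp add: k_clique_def pairwise_def)
        then show "\<chi> {e i, e j} = c" by simp
      qed
      have KU: "?A (e i) t \<and> ?A t (e i)" if "i \<in> K" "t \<in> U" for i t
      proof -
        have i: "i < n" using K(1) that by auto
        have "P' Blue (e i) t \<and> P' Blue t (e i)"
          unfolding P'_def using eY[OF i] U(1) that(2) by blast
        moreover have "\<chi> {e i, t} = c" using cKU[OF i that(2)] .
        moreover from this have "\<chi> {t, e i} = c" by (simp add: insert_commute)
        ultimately show ?thesis by blast
      qed
      have UU: "?A s t" if "s \<in> U" "t \<in> U" "s \<noteq> t" for s t
        using cU[OF that] T_adj[OF subsetD[OF U(1)] subsetD[OF U(1)]] that by simp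
      have "pairwise ?A (e ` K \<union> U)"
      proof (rule pairwiseI)
        fix x y assume "x \<in> e ` K \<union> U" "y \<in> e ` K \<union> U" "x \<noteq> y"
        then show "?A x y" using KK KU UU by (elim UnE imageE) simp_all
      qed
      then have "k_clique k ?A (e ` K \<union> U)"
        using card \<open>finite U\<close> K(2) by (simp add: k_clique_def)
      moreover have "e ` K \<union> U \<subseteq> Y \<union> T" using eK U(1) by auto
      ultimately show ?thesis by blast
    qed
    have to_T: "\<chi> {e i, t} = (if t \<in> D then Red else Blue)" if "i < n" "t \<in> T" for i t
      using D that by (cases "\<chi> {e i, t}") auto
    consider t t' where "t \<in> T" "t \<in> D" "t' \<in> T" "t' \<notin> D" | c where "\<forall>t\<in>T. (if t \<in> D then Red else Blue) = c"
      by (metis (full_types))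
    then show ?thesis
    proof cases
      case 1
      from arrows1[unfolded arrows_def, rule_format, of "\<lambda>S. \<chi> (e ` S)"] show ?thesis
      proof (elim disjE exE conjE)
        fix K assume "K \<subseteq> {..<n}" "k_clique (k - 1) (\<lambda>i j. \<chi> (e ` {i, j}) = Red) K"
        from build[OF this, of "{t}"] show ?thesis using 1 k to_T by simp
      next
        fix K assume "K \<subseteq> {..<n}" "k_clique (k - 1) (\<lambda>i j. \<chi> (e ` {i, j}) = Blue) K"
        from build[OF this, of "{t'}"] show ?thesis using 1 k to_T by simp
      qed
    next
      case 2
      have c: "\<chi> {e i, t} = c" if "i < n" "t \<in> T" for i t using to_T[OF that] 2 that(2) by simp
      obtain s t where st: "s \<in> T" "t \<in> T" "s \<noteq> t" "\<chi> {s, t} = c" using edge by blast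
      have small: ?thesis if "K \<subseteq> {..<n}" "k_clique (k - 2) (\<lambda>i j. \<chi> (e ` {i, j}) = c) K" for K
      proof (rule build[OF that, of "{s, t}"])
        show "k - 2 + card {s, t} = k" using st(3) k by simp
        show "\<chi> {x, y} = c" if "x \<in> {s, t}" "y \<in> {s, t}" "x \<noteq> y" for x y
        proof -
          have "{x, y} = {s, t}" using that by auto
          then show ?thesis using st(4) by simp
        qed
        show "\<chi> {e i, x} = c" if "i < n" "x \<in> {s, t}" for i x
          using that(2) c[OF that(1)] st(1,2) by auto
      qed (use st in simp)
      have large: ?thesis if "K \<subseteq> {..<n}" "k_clique k (\<lambda>i j. \<chi> (e ` {i, j}) = d) K" for K d
        by (rule build[OF that, of "{}"]) simp_all
      show ?thesis
      proof (cases c)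
        case Red
        from arrows_commute[OF arrows2, unfolded arrows_def, rule_format, of "\<lambda>S. \<chi> (e ` S)"]
        show ?thesis using small[unfolded Red] large by (elim disjE exE conjE)
      next
        case Blue
        from arrows2[unfolded arrows_def, rule_format, of "\<lambda>S. \<chi> (e ` S)"]
        show ?thesis using small[unfolded Blue] large by (elim disjE exE conjE)
      qed
    qed
  qed
qed

lemma join_clique_forcing: "clique_forcing k (Y \<union> T) P'"
proof -
  have "T \<noteq> {}" using T k by auto
  then show ?thesis
    unfolding clique_forcing_def using join_graph join_no_blue join_no_pendent join_forcing by simp
qed

end

text \<open>For \<open>k = 2\<close> one red edge suffices, since a clique with a pendent edge then
  needs three vertices.\<close>

lemma clique_forcing_two: "\<exists>V P. clique_forcing 2 V P"
proof -
  define P where "P c u v \<longleftrightarrow> c = Red \<and> {u, v} = {0, 1}" for c and u v :: nat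
  have unique: "v = v'" if "P c u v" "P c' u v'" for c c' u v v'
    using that by (auto simp: P_def doubleton_eq_iff)
  have graph: "coloured_graph {0, 1} P"
    unfolding coloured_graph_def by (auto simp: P_def doubleton_eq_iff)
  have no_blue: "\<not> k_clique 2 (P Blue) K" for K
    using k_clique_imp_neighbour[of 2 "P Blue" K] card_gt_0_iff[of K] by (auto simp: P_def k_clique_def)
  have no_red: "\<not> has_pendent 2 (P Red)"
  proof
    assume "has_pendent 2 (P Red)"
    then obtain K u w where K: "k_clique 2 (P Red) K" "u \<in> K" "w \<notin> K" "P Red u w"
      by (rule has_pendentE)
    then obtain y where y: "y \<in> K" "y \<noteq> u" using card_two_ex_other[of K u] by (auto simp: k_clique_def)
    then have "P Red u y" using K by (simp add: k_clique_def pairwise_def)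
    then show False using unique K y by blast
  qed
  have "\<exists>c K. K \<subseteq> {0, 1} \<and> k_clique 2 (\<lambda>u v. (\<exists>d. P d u v) \<and> \<chi> {u, v} = c) K"
    for \<chi> :: "nat set \<Rightarrow> colour"
    by (rule exI[of _ "\<chi> {0, 1}"], rule exI[of _ "{0, 1}"])
      (simp add: k_clique_def pairwise_insert P_def insert_commute)
  then have "clique_forcing 2 {0, 1} P"
    unfolding clique_forcing_def using graph no_blue no_red by simp
  then show ?thesis by blast
qed

lemma clique_forcing_exists:
  assumes "k \<ge> 2"
  shows "\<exists>V P. clique_forcing k V P"
proof (cases "k = 2")
  case True
  then show ?thesis using clique_forcing_two by simp
next
  case False
  then have k: "k \<ge> 3" using assms by simp
  obtain N where N: "arrows N k (k - 1)" using arrows_exists by blast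
  have "\<not> arrows 0 k (k - 1)" using k by (auto simp: arrows_def k_clique_def)
  \<comment> \<open>\<open>Suc n\<close> is the Ramsey number for red \<open>k\<close> and blue
    \<open>k - 1\<close>. So \<open>n\<close> points still have a colouring \<open>\<alpha>\<close>
    avoiding both, and lowering either clique size by 1 gives the two arrows for
    \<open>n\<close>.\<close>
  from ex_least_nat_less[OF N this]
  obtain n where not: "\<not> arrows n k (k - 1)" and arrow: "arrows (Suc n) k (k - 1)" by auto
  have a1: "arrows n (k - 1) (k - 1)"
    by (rule arrows_Suc) (use arrow k in simp_all)
  have "arrows n (k - 2) k"
    by (rule arrows_Suc) (use arrows_commute[OF arrow] k in \<open>simp_all add: Suc_diff_Suc numeral_2_eq_2\<close>)
  then have a2: "arrows n k (k - 2)" by (rule arrows_commute)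
  have "n > 0"
  proof (rule ccontr)
    assume "\<not> n > 0"
    then show False using a1 k by (auto simp: arrows_def k_clique_def)
  qed
  from not obtain \<alpha> :: "nat set \<Rightarrow> colour"
    where \<alpha>: "\<And>K. K \<subseteq> {..<n} \<Longrightarrow> \<not> k_clique k (\<lambda>x y. \<alpha> {x, y} = Red) K"
      "\<And>K. K \<subseteq> {..<n} \<Longrightarrow> \<not> k_clique (k - 1) (\<lambda>x y. \<alpha> {x, y} = Blue) K"
    unfolding arrows_def by blast
  have "finite (Pow {..<k})" by simp
  from vertex_ramsey[OF this \<open>n > 0\<close>, of \<alpha>] obtain Y P where YP: "coloured_graph Y P \<and> Y \<noteq> {} \<and>
    (\<forall>c s K. 2 \<le> s \<longrightarrow> k_clique s (P c) K \<longrightarrow> (\<exists>K\<subseteq>{..<n}. k_clique s (\<lambda>i j. \<alpha> {i, j} = c) K)) \<and>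
    (\<forall>f :: nat \<Rightarrow> nat set. f ` Y \<subseteq> Pow {..<k} \<longrightarrow>
      (\<exists>e d. e ` {..<n} \<subseteq> Y \<and> pattern_copy \<alpha> n P e \<and> (\<forall>i<n. f (e i) = d)))"
    by (elim exE)
  note Y = YP[THEN conjunct1]
  note cl = YP[THEN conjunct2, THEN conjunct2, THEN conjunct1, rule_format]
  have "infinite (UNIV - Y)" using Y by (simp add: coloured_graph_def Diff_infinite_finite)
  from infinite_arbitrarily_large[OF this] obtain T where T: "finite T" "card T = k" "T \<subseteq> UNIV - Y"
    by blast
  \<comment> \<open>\<open>T\<close> has to avoid \<open>Y\<close> and is picked after it, so the
    colours in use are the subsets of \<open>{..<k}\<close>, identified with those of
    \<open>T\<close> by \<open>h\<close>.\<close>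
  obtain h where h: "bij_betw h T {..<k}"
    using finite_same_card_bij[of T "{..<k}"] T by auto
  interpret clique_join k n \<alpha> Y P T
  proof
    show "\<exists>e D. e ` {..<n} \<subseteq> Y \<and> pattern_copy \<alpha> n P e \<and> (\<forall>i<n. f (e i) = D)"
      if f: "f ` Y \<subseteq> Pow T" for f
    proof -
      have "h ` f x \<subseteq> {..<k}" if "x \<in> Y" for x
        using f that bij_betw_imp_surj_on[OF h] by blast
      then have "(\<lambda>x. h ` f x) ` Y \<subseteq> Pow {..<k}" by auto
      from YP[THEN conjunct2, THEN conjunct2, THEN conjunct2, THEN spec, THEN mp, OF this]
      obtain e d where e: "e ` {..<n} \<subseteq> Y" "pattern_copy \<alpha> n P e" "\<forall>i<n. h ` f (e i) = d"
        by (elim exE conjE)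
      have "f (e i) = f (e 0)" if "i < n" for i
      proof -
        have sub: "f (e i) \<subseteq> T" "f (e 0) \<subseteq> T"
          using f e(1) that \<open>n > 0\<close> by (simp_all add: image_subset_iff)
        have "h ` f (e i) = h ` f (e 0)" using e(3) that \<open>n > 0\<close> by simp
        then show ?thesis using inj_on_image_eq_iff[OF bij_betw_imp_inj_on[OF h] sub] by simp
      qed
      then show ?thesis using e(1,2) by blast
    qed
    show "\<not> k_clique k (P Red) K" for K
      using cl[of k Red K] \<alpha>(1) k by auto
    show "\<not> k_clique (k - 1) (P Blue) K" for K
    proof
      assume K: "k_clique (k - 1) (P Blue) K"
      have "2 \<le> k - 1" using k by simp
      from cl[OF this K] show False using \<alpha>(2) by blast
    qed
  qed (use k a1 a2 Y T in auto)
  show ?thesis using join_clique_forcing by blast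
qed

section \<open>A Ramsey graph with vertices of degree at most \<open>k - 1\<close>\<close>

lemma pendent_free_opp:
  assumes "\<And>c. \<not> has_pendent k (mono_adj E \<chi> c)" "k_clique k (mono_adj E \<chi> c) K"
    and "u \<in> K" "w \<notin> K" "{u, w} \<in> E"
  shows "\<chi> {u, w} = opp c"
proof (rule ccontr)
  assume "\<chi> {u, w} \<noteq> opp c"
  then have "\<chi> {u, w} = c" by (cases c; cases "\<chi> {u, w}") auto
  then show False using assms has_pendentI[of k "mono_adj E \<chi> c" K u w] by (simp add: mono_adj_def)
qed

text \<open>Without \<open>W\<close> the graph is no longer Ramsey, so each of its minimal Ramsey
  subgraphs keeps a vertex of \<open>W\<close>, and such a vertex has degree at most
  \<open>k - 1\<close> there.\<close>

lemma ramsey_graph_low_degree_set: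
  assumes k: "k \<ge> 2"
  shows "\<exists>(E :: nat set set) W. finite E \<and> (\<forall>e\<in>E. card e = 2) \<and>
    (\<forall>\<chi>. \<exists>c. has_pendent k (mono_adj E \<chi> c)) \<and>
    (\<exists>\<chi>. \<forall>c. \<not> has_pendent k (mono_adj {e \<in> E. e \<inter> W = {}} \<chi> c)) \<and>
    (\<forall>w\<in>W. card {e \<in> E. w \<in> e} \<le> k - 1)"
proof -
  obtain V P where F: "clique_forcing k V P" using clique_forcing_exists[OF k] by blast
  then have V: "coloured_graph V P" "V \<noteq> {}" and no_blue: "\<not> k_clique k (P Blue) K"
    and no_red: "\<not> has_pendent k (P Red)" for K
    by (simp_all add: clique_forcing_def)
  have force: "\<exists>c K. K \<subseteq> V \<and> k_clique k (\<lambda>u v. (\<exists>d. P d u v) \<and> \<chi> {u, v} = c) K"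
    for \<chi> :: "nat set \<Rightarrow> colour"
    by (rule F[unfolded clique_forcing_def, THEN conjunct2, THEN conjunct2, THEN conjunct2, THEN conjunct2, THEN spec])
  \<comment> \<open>The constant pattern makes the connecting cliques on \<open>k - 1\<close> points
    blue.\<close>
  obtain Z Q \<P> where Z: "amalgam V P (\<lambda>_. Blue) (k - 1) Z Q \<P>"
    using amalgam_exists[OF V] by blast
  have Q: "u \<in> Z \<and> v \<in> Z \<and> u \<noteq> v \<and> Q c v u" if "Q c u v" for c u v
    using amalgam_graph[OF Z] that unfolding coloured_graph_def by blast
  have finZ: "finite Z" using amalgam_graph[OF Z] by (simp add: coloured_graph_def)
  obtain N where N: "\<And>z. z \<in> Z \<Longrightarrow> z < N" using finite_nat_set_iff_bounded[of Z] finZ by auto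
  \<comment> \<open>Two new vertices for each set \<open>U\<close>, told apart by
    \<open>b < 2\<close>; they are at least \<open>N\<close> and so outside
    \<open>Z\<close>.\<close>
  define w where "w U b = N + 2 * set_encode U + b" for U and b :: nat
  define \<U> where "\<U> = {U. U \<subseteq> Z \<and> card U = k - 1}"
  define E0 where "E0 = {{u, v} | u v. \<exists>c. Q c u v}"
  define E1 where "E1 = {{w U b, u} | U b u. U \<in> \<U> \<and> b < 2 \<and> u \<in> U}"
  have wZ: "w U b \<notin> Z" for U b using N[of "w U b"] by (auto simp: w_def)
  have fin\<U>: "finite U" if "U \<in> \<U>" for U using that finZ finite_subset by (auto simp: \<U>_def)
  have w_inj: "U = U'" if "w U b = w U' b'" "U \<in> \<U>" "U' \<in> \<U>" "b < 2" "b' < 2" for U U' b b'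
  proof -
    have "set_encode U = set_encode U'" using that(1,4,5) unfolding w_def by presburger
    then show ?thesis using set_encode_eq fin\<U> that by blast
  qed
  have "finite E0"
    by (rule finite_subset[of _ "Pow Z"]) (use Q finZ in \<open>auto simp: E0_def\<close>)
  moreover have "finite E1"
  proof -
    have "E1 \<subseteq> (\<lambda>(U, b, u). {w U b, u}) ` (Pow Z \<times> {..<2} \<times> Z)"
      by (force simp: E1_def \<U>_def)
    then show ?thesis using finZ finite_subset by fastforce
  qed
  ultimately have "finite (E0 \<union> E1)" by simp
  moreover have "\<forall>e\<in>E0 \<union> E1. card e = 2"
  proof
    fix e assume "e \<in> E0 \<union> E1"
    then consider u v c where "e = {u, v}" "Q c u v" | U b u where "e = {w U b, u}" "U \<in> \<U>" "u \<in> U"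
      unfolding E0_def E1_def by blast
    then show "card e = 2"
    proof cases
      case 1
      then show ?thesis using Q[OF 1(2)] by simp
    next
      case 2
      then have "u \<in> Z" by (auto simp: \<U>_def)
      then have "w U b \<noteq> u" using wZ by metis
      then show ?thesis using 2 by simp
    qed
  qed
  moreover have "\<forall>\<chi>. \<exists>c. has_pendent k (mono_adj (E0 \<union> E1) \<chi> c)"
  proof (rule allI, rule ccontr)
    let ?E = "E0 \<union> E1"
    fix \<chi>
    assume "\<nexists>c. has_pendent k (mono_adj ?E \<chi> c)"
    then have free: "\<And>c. \<not> has_pendent k (mono_adj ?E \<chi> c)" by blast
    \<comment> \<open>\<open>S\<close> collects the vertices of monochromatic cliques inside copies;
      each copy has one because it is Ramsey for the clique.\<close>
    define S where "S = {x. \<exists>p\<in>\<P>. \<exists>c K. x \<in> K \<and> K \<subseteq> p ` V \<and> k_clique k (mono_adj ?E \<chi> c) K}"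
    have "S \<inter> p ` V \<noteq> {}" if p: "p \<in> \<P>" for p
    proof -
      have inj: "inj_on p V" and pP: "\<And>c u v. P c u v \<Longrightarrow> Q c (p u) (p v)"
        using amalgam_copy[OF Z p] by simp_all
      from force[of "\<lambda>e. \<chi> (p ` e)"] obtain c K where K: "K \<subseteq> V"
        "k_clique k (\<lambda>u v. (\<exists>d. P d u v) \<and> \<chi> (p ` {u, v}) = c) K" by blast
      have "k_clique k (mono_adj ?E \<chi> c) (p ` K)"
        unfolding k_clique_def
      proof (intro conjI)
        show "finite (p ` K)" using K by (simp add: k_clique_def)
        show "card (p ` K) = k" using K card_image[OF inj_on_subset[OF inj K(1)]] by (simp add: k_clique_def)
        show "pairwise (mono_adj ?E \<chi> c) (p ` K)"
        proof (rule pairwiseI)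
          fix x y assume "x \<in> p ` K" "y \<in> p ` K" "x \<noteq> y"
          then obtain u v where uv: "u \<in> K" "v \<in> K" "u \<noteq> v" "x = p u" "y = p v" by blast
          then have "(\<exists>d. P d u v) \<and> \<chi> (p ` {u, v}) = c" using K(2) by (simp add: k_clique_def pairwise_def)
          moreover from this have "{x, y} \<in> E0" using pP uv(4,5) unfolding E0_def by blast
          ultimately show "mono_adj ?E \<chi> c x y" using uv by (simp add: mono_adj_def)
        qed
      qed
      moreover obtain x where "x \<in> K" using K(2) k by (cases "K = {}") (auto simp: k_clique_def)
      ultimately have "p x \<in> S" unfolding S_def using K(1) p by blast
      then show ?thesis using \<open>x \<in> K\<close> K(1) by blast
    qed
    from amalgam_hitting[OF Z this] obtain f where f: "f ` {..<k - 1} \<subseteq> S \<inter> Z"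
      "pattern_copy (\<lambda>_. Blue) (k - 1) Q f"
      "\<forall>p\<in>\<P>. \<forall>i<k - 1. \<forall>j<k - 1. f i \<in> p ` V \<longrightarrow> f j \<in> p ` V \<longrightarrow> i = j"
      by blast
    define U where "U = f ` {..<k - 1}"
    have f_adj: "Q Blue (f i) (f j)" if "i < k - 1" "j < k - 1" "i \<noteq> j" for i j
      using f(2) that by (simp add: pattern_copy_def)
    have "inj_on f {..<k - 1}"
    proof (rule inj_onI, rule ccontr)
      fix i j assume "i \<in> {..<k - 1}" "j \<in> {..<k - 1}" "f i = f j" "i \<noteq> j"
      then show False using f_adj[of i j] Q[of Blue "f i" "f j"] by simp
    qed
    then have cardU: "card U = k - 1" by (simp add: U_def card_image)
    then have U\<U>: "U \<in> \<U>" using f(1) by (simp add: \<U>_def U_def)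
    have edgeU: "{u, v} \<in> E0" if uv: "u \<in> U" "v \<in> U" "u \<noteq> v" for u v
    proof -
      obtain i j where "i < k - 1" "j < k - 1" "u = f i" "v = f j" using uv(1,2) unfolding U_def by auto
      then have "Q Blue u v" using f_adj[of i j] uv(3) by auto
      then show ?thesis unfolding E0_def by blast
    qed
    \<comment> \<open>The clique through \<open>u\<close> lies in a copy that meets \<open>U\<close>
      only in \<open>u\<close>; hence all these edges leave it and have the opposite colour.\<close>
    have "\<exists>c. \<forall>v. (v \<in> U \<and> v \<noteq> u \<or> v \<notin> Z) \<and> {u, v} \<in> ?E \<longrightarrow> \<chi> {u, v} = c" if u: "u \<in> U" for u
    proof -
      have "u \<in> S" using u f(1) by (auto simp: U_def)
      then obtain p c K where p: "p \<in> \<P>" "u \<in> K" "K \<subseteq> p ` V" "k_clique k (mono_adj ?E \<chi> c) K"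
        unfolding S_def by blast
      have "v \<notin> K" if v: "v \<in> U \<and> v \<noteq> u \<or> v \<notin> Z" for v
      proof
        assume "v \<in> K"
        then have "v \<in> Z" using amalgam_copy[OF Z p(1)] p(3) by auto
        then have "v \<in> U" "v \<noteq> u" using v by auto
        then obtain i j where ij: "i < k - 1" "j < k - 1" "u = f i" "v = f j"
          using u unfolding U_def by auto
        then have "f i \<in> p ` V" "f j \<in> p ` V"
          using subsetD[OF p(3,2)] subsetD[OF p(3) \<open>v \<in> K\<close>] by simp_all
        from f(3)[rule_format, OF p(1) ij(1,2) this] show False using ij(3,4) \<open>v \<noteq> u\<close> by simp
      qed
      then have "\<chi> {u, v} = opp c" if "(v \<in> U \<and> v \<noteq> u \<or> v \<notin> Z) \<and> {u, v} \<in> ?E" for v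
        using pendent_free_opp[OF free p(4,2), of v] that by blast
      then show ?thesis by (intro exI[of _ "opp c"]) simp
    qed
    then obtain g where g: "\<And>u v. u \<in> U \<Longrightarrow> v \<in> U \<and> v \<noteq> u \<or> v \<notin> Z \<Longrightarrow> {u, v} \<in> ?E \<Longrightarrow> \<chi> {u, v} = g u"
      by metis
    obtain u0 where u0: "u0 \<in> U" using cardU k by (cases "U = {}") auto
    \<comment> \<open>The edge from \<open>u\<close> to \<open>u0\<close> leaves the cliques at both
      of its ends, which equates \<open>g u\<close> and \<open>g u0\<close>.\<close>
    have g_const: "g u = g u0" if "u \<in> U" for u
    proof (cases "u = u0")
      case False
      then show ?thesis using g[of u u0] g[of u0 u] that u0 edgeU[of u u0] by (simp add: insert_commute)
    qed simp
    have new: "{u, w U b} \<in> ?E" if "u \<in> U" "b < 2" for u b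
      using that U\<U> unfolding E1_def by (auto simp: insert_commute)
    have adj: "mono_adj ?E \<chi> (g u0) u v" if "u \<in> U" "v \<in> U \<and> v \<noteq> u \<or> v \<notin> Z" "{u, v} \<in> ?E" for u v
      using g[OF that] that(3) g_const[OF that(1)] by (simp add: mono_adj_def)
    have adj_new: "mono_adj ?E \<chi> (g u0) u (w U b)" if "u \<in> U" "b < 2" for u b
      using adj[OF that(1) _ new[OF that]] wZ by simp
    \<comment> \<open>\<open>U\<close> with one new vertex is a monochromatic clique, and the other
      new vertex is its pendent leaf.\<close>
    have "k_clique k (mono_adj ?E \<chi> (g u0)) (insert (w U 0) U)"
      unfolding k_clique_def
    proof (intro conjI)
      have "w U 0 \<notin> U" using wZ f(1) unfolding U_def by blast
      then show "card (insert (w U 0) U) = k" using cardU k fin\<U>[OF U\<U>] by simp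
      show "pairwise (mono_adj ?E \<chi> (g u0)) (insert (w U 0) U)"
        unfolding pairwise_insert
      proof (intro conjI allI impI pairwiseI)
        fix y assume "y \<in> U \<and> y \<noteq> w U 0"
        then show "mono_adj ?E \<chi> (g u0) y (w U 0)" using adj_new[of y 0] by simp
        then show "mono_adj ?E \<chi> (g u0) (w U 0) y" by (simp only: mono_adj_commute)
      next
        fix x y assume "x \<in> U" "y \<in> U" "x \<noteq> y"
        then show "mono_adj ?E \<chi> (g u0) x y" using adj[of x y] edgeU[of x y] by simp
      qed
    qed (use fin\<U>[OF U\<U>] in simp)
    moreover have "w U 1 \<notin> insert (w U 0) U"
    proof -
      have "w U 1 \<notin> U" using wZ f(1) unfolding U_def by blast
      then show ?thesis by (simp add: w_def)
    qed
    moreover have "mono_adj ?E \<chi> (g u0) u0 (w U 1)" using adj_new[OF u0, of 1] by simp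
    ultimately have "has_pendent k (mono_adj ?E \<chi> (g u0))"
      using u0 by (intro has_pendentI[of k _ "insert (w U 0) U" u0 "w U 1"]) simp_all
    with free show False ..
  qed
  moreover have "\<exists>\<chi>. \<forall>c. \<not> has_pendent k (mono_adj {e \<in> E0 \<union> E1. e \<inter> {N..} = {}} \<chi> c)"
  proof -
    \<comment> \<open>Once \<open>{N..}\<close> is avoided only edges of the amalgam remain, and
      these take their colours from \<open>Q\<close>.\<close>
    define \<chi> where "\<chi> e = (if \<exists>u v. e = {u, v} \<and> Q Red u v then Red else Blue)" for e
    have "Q c u v" if "mono_adj {e \<in> E0 \<union> E1. e \<inter> {N..} = {}} \<chi> c u v" for c u v
    proof -
      have sym: "Q d u v" if "{u, v} = {a, b}" "Q d a b" for a b d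
        using that(1) unfolding doubleton_eq_iff using that(2) Q[OF that(2)] by (elim disjE conjE) simp_all
      have uv: "{u, v} \<inter> {N..} = {}" "{u, v} \<in> E0 \<union> E1" "\<chi> {u, v} = c"
        using that unfolding mono_adj_def by blast+
      have "{u, v} \<notin> E1"
      proof
        assume "{u, v} \<in> E1"
        then obtain U b where "w U b \<in> {u, v}" unfolding E1_def by blast
        moreover have "w U b \<in> {N..}" by (simp add: w_def)
        ultimately show False using uv(1) by blast
      qed
      then have "{u, v} \<in> E0" using uv(2) by blast
      then obtain a b d where "{u, v} = {a, b}" "Q d a b" unfolding E0_def by blast
      then have d: "Q d u v" by (rule sym)
      show ?thesis
      proof (cases c)
        case Red
        then have "\<exists>a b. {u, v} = {a, b} \<and> Q Red a b"
          using uv(3) unfolding \<chi>_def by (metis colour.distinct(1))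
        then show ?thesis using sym Red by blast
      next
        case Blue
        have "\<not> Q Red u v"
        proof
          assume "Q Red u v"
          then have "\<chi> {u, v} = Red" unfolding \<chi>_def by (intro if_P) blast
          then show False using uv(3) Blue by simp
        qed
        then show ?thesis using d Blue by (cases d) auto
      qed
    qed
    note sub = this
    have "\<not> has_pendent k (Q c)" for c
    proof
      assume pen: "has_pendent k (Q c)"
      show False
      proof (cases c)
        case Red
        then show False using amalgam_pendent[OF Z k pen] no_red by simp
      next
        case Blue
        \<comment> \<open>A blue clique on \<open>k\<close> vertices would have to come from
          \<open>P Blue\<close> or fit into \<open>k - 1\<close> indices.\<close>
        obtain K where "k_clique k (Q c) K" using pen by (rule has_pendentE)
        from amalgam_clique[OF Z k this] no_blue Blue
        obtain K where "K \<subseteq> {..<k - 1}" "card K = k" by (auto simp: k_clique_def)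
        then show False using card_mono[of "{..<k - 1}" K] k by simp
      qed
    qed
    then show ?thesis using has_pendent_mono sub by blast
  qed
  moreover have "\<forall>x\<in>{N..}. card {e \<in> E0 \<union> E1. x \<in> e} \<le> k - 1"
  proof
    fix x assume "x \<in> {N..}"
    then have "x \<notin> Z" using N[of x] by auto
    then have no0: "x \<notin> e" if "e \<in> E0" for e using that Q unfolding E0_def by blast
    show "card {e \<in> E0 \<union> E1. x \<in> e} \<le> k - 1"
    proof (cases "\<exists>U\<in>\<U>. \<exists>b<2. x = w U b")
      case False
      have "x \<notin> e" if "e \<in> E1" for e using that False \<open>x \<notin> Z\<close> unfolding E1_def \<U>_def by blast
      then have "{e \<in> E0 \<union> E1. x \<in> e} = {}" using no0 by blast
      then show ?thesis by (simp only: card.empty zero_le)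
    next
      case True
      then obtain U b where U: "U \<in> \<U>" "b < 2" "x = w U b" by blast
      have "{e \<in> E0 \<union> E1. x \<in> e} \<subseteq> (\<lambda>u. {x, u}) ` U"
      proof
        fix e assume "e \<in> {e \<in> E0 \<union> E1. x \<in> e}"
        then have "e \<in> E1" "x \<in> e" using no0 by blast+
        then obtain U' b' u where e: "e = {w U' b', u}" "U' \<in> \<U>" "b' < 2" "u \<in> U'" unfolding E1_def by blast
        then have "u \<in> Z" by (auto simp: \<U>_def)
        then have "x = w U' b'" using \<open>x \<in> e\<close> e(1) \<open>x \<notin> Z\<close> by auto
        then have "U' = U" using w_inj U e by metis
        then show "e \<in> (\<lambda>u. {x, u}) ` U" using e \<open>x = w U' b'\<close> by blast
      qed
      then have "card {e \<in> E0 \<union> E1. x \<in> e} \<le> card U" using surj_card_le fin\<U>[OF U(1)] by blast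
      then show ?thesis using U(1) by (simp add: \<U>_def)
    qed
  qed
  ultimately show ?thesis by (intro exI[of _ "E0 \<union> E1"] exI[of _ "{N..}"] conjI) auto
qed

subsection \<open>Minimal Ramsey graphs\<close>

lemma subgraph_refl: "simple_graph G \<Longrightarrow> subgraph G G"
  by (simp add: subgraph_def)

lemma subgraph_trans: "subgraph G'' G' \<Longrightarrow> subgraph G' G \<Longrightarrow> subgraph G'' G"
  by (auto simp: subgraph_def)

lemma finite_edges: "simple_graph G \<Longrightarrow> finite (edges G)"
  by (meson simple_graph_def finite_imp_finite_nsets finite_subset)

text \<open>A Ramsey subgraph with the least total of vertices and edges is minimal, as a proper
  subgraph has a smaller total.\<close>

lemma ramsey_minimal_subgraph:
  assumes "simple_graph G" "ramsey_for G H"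
  obtains M where "subgraph M G" "ramsey_minimal H M"
proof -
  let ?P = "\<lambda>M. subgraph M G \<and> ramsey_for M H"
  let ?size = "\<lambda>M. card (verts M) + card (edges M)"
  have "?P G" using assms subgraph_refl by blast
  from ex_has_least_nat[of ?P, OF this, of ?size]
  obtain M where M: "subgraph M G" "ramsey_for M H" and least: "\<And>M'. ?P M' \<Longrightarrow> ?size M \<le> ?size M'"
    by blast
  have sM: "simple_graph M" using M(1) by (simp add: subgraph_def)
  have fin: "finite (verts M)" "finite (edges M)" using sM finite_edges[OF sM] by (simp_all add: simple_graph_def)
  have "\<not> ramsey_for M' H" if M': "subgraph M' M" "M' \<noteq> M" for M'
  proof
    assume "ramsey_for M' H"
    then have "?size M \<le> ?size M'" using least M'(1) M(1) subgraph_trans by blast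
    moreover have sub: "verts M' \<subseteq> verts M" "edges M' \<subseteq> edges M" using M'(1) by (auto simp: subgraph_def)
    moreover have "card (verts M') \<le> card (verts M)" "card (edges M') \<le> card (edges M)"
      using card_mono[OF fin(1) sub(1)] card_mono[OF fin(2) sub(2)] by blast+
    ultimately have "card (verts M') = card (verts M)" "card (edges M') = card (edges M)" by linarith+
    then have "verts M' = verts M" "edges M' = edges M"
      using card_subset_eq[OF fin(1) sub(1)] card_subset_eq[OF fin(2) sub(2)] by blast+
    then show False using M'(2) by (simp add: prod_eq_iff)
  qed
  then show ?thesis using that M sM by (auto simp: ramsey_minimal_def)
qed

text \<open>By minimality \<open>M\<close> without \<open>x\<close> has a colouring free of the
  pattern; if the degree of \<open>x\<close> were smaller, it would extend to
  \<open>M\<close>.\<close>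

lemma ramsey_minimal_degree_ge:
  assumes k: "k \<ge> 2" and M: "ramsey_minimal (clique_pendent k) M" and x: "x \<in> verts M"
  shows "k - 1 \<le> degree M x"
proof (rule ccontr)
  assume "\<not> k - 1 \<le> degree M x"
  then have deg: "card {e \<in> edges M. x \<in> e} < k - 1" by (simp add: degree_def)
  have sM: "simple_graph M" and ram: "ramsey_for M (clique_pendent k)"
    and min: "\<And>G'. subgraph G' M \<Longrightarrow> G' \<noteq> M \<Longrightarrow> \<not> ramsey_for G' (clique_pendent k)"
    using M by (auto simp: ramsey_minimal_def)
  let ?G = "(verts M - {x}, {e \<in> edges M. x \<notin> e})"
  have sG: "simple_graph ?G" using sM by (auto simp: simple_graph_def nsets_def)
  then have "subgraph ?G M" by (auto simp: subgraph_def)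
  moreover have "?G \<noteq> M" using x by (metis Diff_iff fst_conv insertI1)
  ultimately have "\<not> ramsey_for ?G (clique_pendent k)" using min by blast
  then obtain \<chi> where "\<And>c. \<not> has_pendent k (mono_adj {e \<in> edges M. x \<notin> e} \<chi> c)"
    using ramsey_for_clique_pendent_iff[OF sG k] by auto
  from extend_pendent_free[OF _ deg this] have "\<exists>\<chi>. \<forall>c. \<not> has_pendent k (mono_adj (edges M) \<chi> c)"
    using finite_edges[OF sM] by simp
  then show False using ram ramsey_for_clique_pendent_iff[OF sM k] by blast
qed

lemma ramsey_minimal_min_degree_ge:
  assumes k: "k \<ge> 2" and M: "ramsey_minimal (clique_pendent k) M"
  shows "k - 1 \<le> min_degree M"
proof -
  have sM: "simple_graph M" and "ramsey_for M (clique_pendent k)" using M by (auto simp: ramsey_minimal_def)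
  \<comment> \<open>A Ramsey graph has an edge, so \<open>Min\<close> is taken over a nonempty
    set.\<close>
  then obtain c where "has_pendent k (mono_adj (edges M) (\<lambda>_. Red) c)"
    using ramsey_for_clique_pendent_iff[OF _ k] by blast
  then obtain u w where "mono_adj (edges M) (\<lambda>_. Red) c u w" by (rule has_pendentE)
  then have "u \<in> verts M" using sM by (auto simp: mono_adj_def simple_graph_def nsets_def)
  then have ne: "verts M \<noteq> {}" by blast
  have "finite (verts M)" using sM by (simp add: simple_graph_def)
  then show "k - 1 \<le> min_degree M"
    unfolding min_degree_def using ne ramsey_minimal_degree_ge[OF k M] by (intro Min.boundedI) auto
qed

lemma ramsey_minimal_exists_low_degree:
  assumes k: "k \<ge> 2"
  shows "\<exists>M :: nat ugraph. ramsey_minimal (clique_pendent k) M \<and> min_degree M \<le> k - 1"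
proof -
  obtain E :: "nat set set" and W where E: "finite E" "\<forall>e\<in>E. card e = 2"
    and ram: "\<forall>\<chi>. \<exists>c. has_pendent k (mono_adj E \<chi> c)"
    and free: "\<exists>\<chi>. \<forall>c. \<not> has_pendent k (mono_adj {e \<in> E. e \<inter> W = {}} \<chi> c)"
    and deg: "\<forall>w\<in>W. card {e \<in> E. w \<in> e} \<le> k - 1"
    using ramsey_graph_low_degree_set[OF k] by blast
  have fin: "finite e" if "e \<in> E" for e using E(2) that by (metis card.infinite zero_neq_numeral)
  let ?G = "(\<Union> E, E)"
  have sG: "simple_graph ?G" using E fin by (auto simp: simple_graph_def nsets_def)
  have "ramsey_for ?G (clique_pendent k)"
    using ram ramsey_for_clique_pendent_iff[OF sG k] by simp
  from ramsey_minimal_subgraph[OF sG this] obtain M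
    where M: "subgraph M ?G" "ramsey_minimal (clique_pendent k) M" by blast
  have sM: "simple_graph M" and rM: "ramsey_for M (clique_pendent k)" using M(2) by (auto simp: ramsey_minimal_def)
  have sub: "edges M \<subseteq> E" using M(1) by (simp add: subgraph_def)
  have "\<exists>w\<in>W. w \<in> verts M"
  proof (rule ccontr)
    assume no: "\<not> (\<exists>w\<in>W. w \<in> verts M)"
    have "edges M \<subseteq> {e \<in> E. e \<inter> W = {}}"
      using sub no sM by (auto simp: simple_graph_def nsets_def)
    then have mono: "mono_adj {e \<in> E. e \<inter> W = {}} \<chi> c x y" if "mono_adj (edges M) \<chi> c x y" for \<chi> c x y
      using that unfolding mono_adj_def by blast
    obtain \<chi> where \<chi>: "\<And>c. \<not> has_pendent k (mono_adj {e \<in> E. e \<inter> W = {}} \<chi> c)" using free by blast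
    obtain c where "has_pendent k (mono_adj (edges M) \<chi> c)"
      using rM ramsey_for_clique_pendent_iff[OF sM k] by blast
    then have "has_pendent k (mono_adj {e \<in> E. e \<inter> W = {}} \<chi> c)"
      by (rule has_pendent_mono) (rule mono)
    with \<chi> show False ..
  qed
  then obtain w where w: "w \<in> W" "w \<in> verts M" by blast
  have "min_degree M \<le> degree M w"
    unfolding min_degree_def using sM w(2) by (intro Min_le) (auto simp: simple_graph_def)
  also have "\<dots> \<le> card {e \<in> E. w \<in> e}"
    unfolding degree_def using sub E(1) by (intro card_mono) auto
  also have "\<dots> \<le> k - 1" using deg w(1) by blast
  finally show ?thesis using M(2) by blast
qed

theorem theorem3:
  fixes k :: nat
  assumes "k \<ge> 2"
  shows "ramsey_min_degree (clique_pendent k) = k - 1"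
  unfolding ramsey_min_degree_def
proof (rule cInf_eq_minimum)
  obtain M :: "nat ugraph" where M: "ramsey_minimal (clique_pendent k) M" "min_degree M \<le> k - 1"
    using ramsey_minimal_exists_low_degree[OF assms] by blast
  then have "min_degree M = k - 1" using ramsey_minimal_min_degree_ge[OF assms M(1)] by (intro le_antisym)
  then show "k - 1 \<in> {min_degree G | G :: nat ugraph. ramsey_minimal (clique_pendent k) G}"
    using M(1) by (metis (mono_tags, lifting) mem_Collect_eq)
next
  fix d assume "d \<in> {min_degree G | G :: nat ugraph. ramsey_minimal (clique_pendent k) G}"
  then show "k - 1 \<le> d" using ramsey_minimal_min_degree_ge[OF assms] by blast
qed

end
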